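(* Let $1<p,q<\infty$ and let $u,v$ be weights on $\mathbf{R}^n$ with $(u,v)\in N_{\mathcal Q}(p,q)$. Each of the following statements implies the next. (i) There is a constant $C$ such that for all cubes $Q$ and all measurable sets $E\subset Q$, $$\frac{u(E)}{u(Q)}\leq C\left(\frac{|E|}{|Q|}\right)^{q/p'}\ \text{ if } p'\geq q,\qquad \frac{|E|}{|Q|}\leq C\left(\frac{v(E)}{v(Q)}\right)^{q'/p}\ \text{ if } p'\leq q.$$ (ii) There is a constant $C$ such that for all bounded, measurable sets $E$ and $F$ with $|F|>0$, $$u(E)^{1/q}\leq C|E|^{1/s}|F|^{-1/s'}v(F)^{1/p},$$ where $s=\max\{p',q\}$. (iii) If $\max\{p',q\}\geq 2$, then the Fourier transform can be extended to functions of the form $\chi_A$, where $A$ is measurable with $v(A)<\infty$, and is restricted weak-type $(p,q)$ with respect to the measures $u$ and $v$; that is, there is a constant $C$ such that $$u(\{z:|\widehat\chi_A(z)|> \alpha\})^{1/q}\leq \frac{C}{\alpha}v(A)^{1/p}$$ for all $\alpha>0$ and all measurable $A$ with $v(A)<\infty$.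
   Context: A weight is a nonnegative, locally integrable function on $\mathbf{R}^n$. For an exponent $r$, $r'=r/(r-1)$; $w=v^{-p'/p}$ is assumed to be locally integrable. For a measurable set $E$, $|E|$ is its Lebesgue measure and $u(E)=\int_E u$, $v(E)=\int_E v$, $w(E)=\int_E w$; $\chi_A$ is the characteristic function of $A$. For $f\in L^1$ the Fourier transform is $\widehat f(z)=\int_{\mathbf{R}^n} f(x)e^{-ix\cdot z}\,dx$. For a bounded set $A\subset\mathbf{R}^n$ containing the origin, its polar is $A^\circ=\{z\in\mathbf{R}^n: |x\cdot z|\le 1\text{ for all }x\in A\}$. One says $(u,v)\in N_{\mathcal Q}(p,q)$ if and only if there is a constant $C$ such that for all cubes $Q$ with sides parallel to the coordinate axes, all $-\mu\in Q$, and all $\tau\in\mathbf{R}^n$, $$u(Q)^{1/q}\,w((Q+\mu)^\circ+\tau)^{1/p'}\leq C\quad\text{and}\quad u((Q+\mu)^\circ+\tau)^{1/q}\,w(Q)^{1/p'}\leq C.$$ $L^{q,\infty}(u)$ is the space of measurable $g$ with finite quasinorm $\|g\|_{L^{q,\infty}(u)}=\sup_{\alpha>0}\alpha\,u(\{z:|g(z)|>\alpha\})^{1/q}$. The extension of the Fourier transform to $\chi_A$ with $v(A)<\infty$ is understood as follows: $\widehat\chi_A:=\lim_{j\to\infty}\widehat\chi_{A_j}$, the limit being in the $L^{q,\infty}(u)$ quasinorm, where $A_j$ is any sequence of bounded measurable sets increasing to $A$. That it "can be extended" means that this limit exists, does not depend on the choice of the sequence $A_j$ (as an element of $L^{q,\infty}(u)$),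 and agrees $u$-almost everywhere with the classical Fourier transform of $\chi_A$ when $|A|<\infty$. *)

theory Defs
  imports "HOL-Analysis.Analysis"
begin

definition conj_exp :: "real \<Rightarrow> real" where
  "conj_exp r = r / (r - 1)"

text \<open>
  Real powers on \<open>[0,\<infinity>]\<close> with the usual conventions: for a negative exponent, \<open>0\<close> is sent to
  \<open>\<infinity>\<close> and \<open>\<infinity>\<close> to \<open>0\<close>. (The real-valued \<open>powr\<close> has \<open>0 powr r = 0\<close> for every \<open>r\<close>.)
\<close>

definition epowr :: "ennreal \<Rightarrow> real \<Rightarrow> ennreal" where
  "epowr x r =
     (if r = 0 then 1
      else if x = 0 then (if 0 < r then 0 else \<infinity>)
      else if x = \<infinity> then (if 0 < r then \<infinity> else 0)
      else ennreal (enn2real x powr r))"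

definition emass :: "(real^'n \<Rightarrow> ennreal) \<Rightarrow> (real^'n) set \<Rightarrow> ennreal" where
  "emass f E = (\<integral>\<^sup>+ x\<in>E. f x \<partial>lebesgue)"

abbreviation mass :: "(real^'n \<Rightarrow> real) \<Rightarrow> (real^'n) set \<Rightarrow> ennreal" where
  "mass u \<equiv> emass (\<lambda>x. ennreal (u x))"

definition locally_integrable :: "(real^'n \<Rightarrow> ennreal) \<Rightarrow> bool" where
  "locally_integrable f \<longleftrightarrow>
     f \<in> borel_measurable lebesgue \<and> (\<forall>K. compact K \<longrightarrow> emass f K < \<infinity>)"

definition weight :: "(real^'n \<Rightarrow> real) \<Rightarrow> bool" where
  "weight u \<longleftrightarrow> (\<forall>x. 0 \<le> u x) \<and> locally_integrable (\<lambda>x. ennreal (u x))"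

text \<open>
  The dual weight \<open>w = v\<^sup>-\<^sup>p\<^sup>'\<^sup>/\<^sup>p\<close> takes the value \<open>\<infinity>\<close> where \<open>v\<close> vanishes; its local
  integrability therefore forces \<open>v > 0\<close> almost everywhere.
\<close>

definition dual_weight :: "real \<Rightarrow> (real^'n \<Rightarrow> real) \<Rightarrow> real^'n \<Rightarrow> ennreal" where
  "dual_weight p v x = epowr (ennreal (v x)) (- (conj_exp p / p))"

definition cubes :: "(real^'n) set set" where
  "cubes = {cbox a (a + (\<chi> i. l)) | a l. 0 < l}"

definition polar :: "(real^'n) set \<Rightarrow> (real^'n) set" where
  "polar A = {z. \<forall>x\<in>A. \<bar>x \<bullet> z\<bar> \<le> 1}"

definition translate :: "(real^'n) set \<Rightarrow> real^'n \<Rightarrow> (real^'n) set" where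
  "translate A t = (\<lambda>x. x + t) ` A"

definition N_Q :: "real \<Rightarrow> real \<Rightarrow> ((real^'n \<Rightarrow> real) \<times> (real^'n \<Rightarrow> real)) set" where
  "N_Q p q = {(u, v). \<exists>C::real. \<forall>Q\<in>cubes. \<forall>\<mu> \<tau>. - \<mu> \<in> Q \<longrightarrow>
     (let P = translate (polar (translate Q \<mu>)) \<tau>; w = dual_weight p v in
       epowr (mass u Q) (1 / q) * epowr (emass w P) (1 / conj_exp p) \<le> ennreal C \<and>
       epowr (mass u P) (1 / q) * epowr (emass w Q) (1 / conj_exp p) \<le> ennreal C)}"

definition fourier :: "(real^'n \<Rightarrow> complex) \<Rightarrow> real^'n \<Rightarrow> complex" where
  "fourier f z = (LINT x|lebesgue. f x * exp (- (\<i> * complex_of_real (x \<bullet> z))))"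

definition weak_norm :: "real \<Rightarrow> (real^'n \<Rightarrow> real) \<Rightarrow> (real^'n \<Rightarrow> complex) \<Rightarrow> ennreal" where
  "weak_norm q u g =
     (SUP \<alpha>\<in>{0<..}. ennreal \<alpha> * epowr (mass u {z. cmod (g z) > \<alpha>}) (1 / q))"

definition weak_L :: "real \<Rightarrow> (real^'n \<Rightarrow> real) \<Rightarrow> (real^'n \<Rightarrow> complex) set" where
  "weak_L q u = {g \<in> borel_measurable lebesgue. weak_norm q u g < \<infinity>}"

definition exhausts :: "(nat \<Rightarrow> (real^'n) set) \<Rightarrow> (real^'n) set \<Rightarrow> bool" where
  "exhausts S A \<longleftrightarrow>
     (\<forall>j. bounded (S j) \<and> S j \<in> sets lebesgue) \<and> incseq S \<and> (\<Union>j. S j) = A"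

text \<open>
  \<open>g\<close> represents the extended Fourier transform of the characteristic function of \<open>A\<close>: it is the
  weak-type limit along every exhaustion, so the limit does not depend on the exhaustion.
\<close>

definition is_fourier_char ::
  "real \<Rightarrow> (real^'n \<Rightarrow> real) \<Rightarrow> (real^'n) set \<Rightarrow> (real^'n \<Rightarrow> complex) \<Rightarrow> bool" where
  "is_fourier_char q u A g \<longleftrightarrow> g \<in> weak_L q u \<and>
     (\<forall>S. exhausts S A \<longrightarrow>
        (\<lambda>j. weak_norm q u (\<lambda>z. fourier (indicator (S j)) z - g z)) \<longlonglongrightarrow> 0)"

definition fourier_extends ::
  "real \<Rightarrow> (real^'n \<Rightarrow> real) \<Rightarrow> (real^'n \<Rightarrow> real) \<Rightarrow> bool" where
  "fourier_extends q u v \<longleftrightarrow> (\<forall>A\<in>sets lebesgue. mass v A < \<infinity> \<longrightarrow>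
     (\<exists>g. is_fourier_char q u A g) \<and>
     (emeasure lebesgue A < \<infinity> \<longrightarrow> (\<forall>g. is_fourier_char q u A g \<longrightarrow>
        (AE z in density lebesgue (\<lambda>z. ennreal (u z)). g z = fourier (indicator A) z))))"

text \<open>
  In the quotients below \<open>|Q| > 0\<close>, and \<open>v Q > 0\<close> whenever the dual weight is locally integrable;
  if \<open>u Q = 0\<close>, then \<open>u E = 0\<close> and the quotient \<open>0 / 0\<close> is \<open>0\<close>, so such cubes impose nothing.
\<close>

definition cube_condition ::
  "real \<Rightarrow> real \<Rightarrow> (real^'n \<Rightarrow> real) \<Rightarrow> (real^'n \<Rightarrow> real) \<Rightarrow> bool" where
  "cube_condition p q u v \<longleftrightarrow>
     (\<exists>C::real. \<forall>Q\<in>cubes. \<forall>E\<in>sets lebesgue. E \<subseteq> Q \<longrightarrow>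
        (conj_exp p \<ge> q \<longrightarrow>
           mass u E / mass u Q
             \<le> ennreal C * epowr (emeasure lebesgue E / emeasure lebesgue Q) (q / conj_exp p)) \<and>
        (conj_exp p \<le> q \<longrightarrow>
           emeasure lebesgue E / emeasure lebesgue Q
             \<le> ennreal C * epowr (mass v E / mass v Q) (conj_exp q / p)))"

definition bounded_set_condition ::
  "real \<Rightarrow> real \<Rightarrow> (real^'n \<Rightarrow> real) \<Rightarrow> (real^'n \<Rightarrow> real) \<Rightarrow> bool" where
  "bounded_set_condition p q u v \<longleftrightarrow>
     (let s = max (conj_exp p) q in
      \<exists>C::real. \<forall>E\<in>sets lebesgue. \<forall>F\<in>sets lebesgue.
        bounded E \<and> bounded F \<and> emeasure lebesgue F > 0 \<longrightarrow>
        epowr (mass u E) (1 / q)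
          \<le> ennreal C * epowr (emeasure lebesgue E) (1 / s)
              * epowr (emeasure lebesgue F) (- (1 / conj_exp s)) * epowr (mass v F) (1 / p))"

definition restricted_weak_type ::
  "real \<Rightarrow> real \<Rightarrow> (real^'n \<Rightarrow> real) \<Rightarrow> (real^'n \<Rightarrow> real) \<Rightarrow> bool" where
  "restricted_weak_type p q u v \<longleftrightarrow>
     (\<exists>C::real. \<forall>\<alpha>>0. \<forall>A\<in>sets lebesgue. mass v A < \<infinity> \<longrightarrow>
        (\<forall>g. is_fourier_char q u A g \<longrightarrow>
           epowr (mass u {z. cmod (g z) > \<alpha>}) (1 / q)
             \<le> ennreal (C / \<alpha>) * epowr (mass v A) (1 / p)))"

end

theory Submission
  imports Defs "HOL-Probability.Characteristic_Functions"
begin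

text \<open>
  The polar of a centred cube of side \<open>l\<close> is a cross-polytope containing the centred cube of side
  \<open>4 / (n l)\<close>, so \<open>N_Q p q\<close> relates \<open>u\<close> on an arbitrary cube of side \<open>l\<close> to the dual weight \<open>w\<close>
  on an arbitrary cube of side \<open>4 / (n l)\<close>, the two positions being independent.

  For the first implication, if \<open>p' \<ge> q\<close>, apply the cube condition to \<open>E\<close> inside a huge cube; this
  yields \<open>w(R) \<le> K |R|\<close> for every small cube \<open>R\<close>, with \<open>K\<close> depending only on \<open>|E|\<close> and \<open>u(E)\<close>.
  A covering argument upgrades this to \<open>w(F) \<le> K |F|\<close>, and Hoelder's inequality
  \<open>|F| \<le> v(F)\<^sup>1\<^sup>/\<^sup>p w(F)\<^sup>1\<^sup>/\<^sup>p\<^sup>'\<close> gives the claim. If \<open>p' \<le> q\<close>, a huge cube around \<open>F\<close> yields in the same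
  way \<open>u(R) \<le> K |R|\<close> for small cubes \<open>R\<close>, hence \<open>u(E) \<le> K |E|\<close>.

  For the second implication, let \<open>s = max p' q \<ge> 2\<close>. The trivial bound of the transform of \<open>\<chi>\<^sub>A\<close>
  by \<open>|A|\<close> and the Plancherel bound give \<open>\<alpha>\<^sup>s |E| \<le> c |A|\<^sup>s\<^sup>-\<^sup>1\<close> for the level set \<open>E\<close> of bounded \<open>A\<close>,
  and the bounded set condition with \<open>F = A\<close> turns this into the weak-type estimate. For general
  \<open>A\<close>, the transforms of \<open>\<chi>\<^sub>A\<close> cut off to balls are Cauchy in \<open>u\<close>-measure; an a.e. limit of a
  subsequence and Fatou's lemma give the extension.
\<close>

section \<open>The Plancherel bound for indicator functions\<close>

lemma lborel_integral_prod:
  fixes f :: "'a::euclidean_space \<Rightarrow> real \<Rightarrow> complex"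
  assumes f: "\<And>b. b \<in> Basis \<Longrightarrow> integrable lborel (f b)"
  shows "integrable (lborel :: 'a measure) (\<lambda>x. \<Prod>b\<in>Basis. f b (x \<bullet> b))"
    and "(LINT x|(lborel :: 'a measure). (\<Prod>b\<in>Basis. f b (x \<bullet> b))) = (\<Prod>b\<in>Basis. LINT t|lborel. f b t)"
proof -
  interpret product_sigma_finite "\<lambda>b::'a. lborel :: real measure"
    by standard
  have [measurable]: "f b \<in> borel_measurable borel" if "b \<in> Basis" for b
    using borel_measurable_integrable[OF f[OF that]] by simp
  \<comment> \<open>\<open>lborel\<close> on the Euclidean space is the image of the product of
    one-dimensional Lebesgue measures under this coordinate map, which reduces both claims to Fubini
    on the product space.\<close>
  have m: "(\<lambda>g. \<Sum>b\<in>Basis. g b *\<^sub>R b) \<in> measurable (Pi\<^sub>M (Basis::'a set) (\<lambda>b. lborel)) (borel :: 'a measure)"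
    by measurable
  have m2: "(\<lambda>x. \<Prod>b\<in>Basis. f b (x \<bullet> b)) \<in> borel_measurable (borel :: 'a measure)"
    by measurable
  have eq: "(\<Prod>b\<in>Basis. f b ((\<Sum>c\<in>Basis. g c *\<^sub>R c) \<bullet> b)) = (\<Prod>b\<in>Basis. f b (g b))" for g :: "'a \<Rightarrow> real"
    by (intro prod.cong refl) (simp add: inner_sum_left inner_Basis if_distrib cong: if_cong)
  show "integrable (lborel :: 'a measure) (\<lambda>x. \<Prod>b\<in>Basis. f b (x \<bullet> b))"
    using product_integrable_prod[of "Basis::'a set" f] f
    by (subst lborel_eq, subst integrable_distr_eq[OF m m2]) (simp add: eq)
  show "(LINT x|(lborel :: 'a measure). (\<Prod>b\<in>Basis. f b (x \<bullet> b))) = (\<Prod>b\<in>Basis. LINT t|lborel. f b t)"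
    using product_integral_prod[of "Basis::'a set" f] f
    by (subst lborel_eq, subst integral_distr[OF m m2]) (simp add: eq)
qed

text \<open>The substitution of s t for t turns the integral into the characteristic function of the
  standard normal distribution at s a.\<close>

lemma char_normal_density:
  assumes s: "0 < s"
  shows "integrable lborel (\<lambda>t. complex_of_real (normal_density 0 s t) * iexp (a * t))"
    and "(LINT t|lborel. complex_of_real (normal_density 0 s t) * iexp (a * t))
           = of_real (exp (- (s * a)\<^sup>2 / 2))"
proof -
  show "integrable lborel (\<lambda>t. complex_of_real (normal_density 0 s t) * iexp (a * t))"
    by (rule Bochner_Integration.integrable_bound[OF integrable_normal_density[OF s, of 0]])
       (auto simp: norm_mult)
  have "(LINT t|lborel. complex_of_real (normal_density 0 s t) * iexp (a * t))
     = s *\<^sub>R (LINT t|lborel. complex_of_real (normal_density 0 s (s * t)) * iexp (a * (s * t)))"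
    using lborel_integral_real_affine[of s "\<lambda>t. complex_of_real (normal_density 0 s t) * iexp (a * t)" 0] s
    by simp
  also have "\<dots> = (LINT t|lborel. std_normal_density t *\<^sub>R iexp (s * a * t))"
    using s
    by (subst integral_scaleR_right[symmetric])
       (auto intro!: Bochner_Integration.integral_cong
        simp: normal_density_def real_sqrt_mult scaleR_conv_of_real power_mult_distrib field_simps)
  also have "\<dots> = char std_normal_distribution (s * a)"
    unfolding char_def by (subst integral_density) auto
  finally show "(LINT t|lborel. complex_of_real (normal_density 0 s t) * iexp (a * t))
           = of_real (exp (- (s * a)\<^sup>2 / 2))"
    by (simp add: char_std_normal_distribution)
qed

text \<open>Density of the centred normal distribution with covariance s^2 times the identity. The
  product form lets integrals factor over coordinates; \<open>gauss_eq\<close> recovers the radial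
  form.\<close>

definition gauss :: "real \<Rightarrow> 'a::euclidean_space \<Rightarrow> real" where
  "gauss s x = (\<Prod>b\<in>Basis. normal_density 0 s (x \<bullet> b))"

lemma gauss_nonneg [simp]: "0 \<le> gauss s x"
  unfolding gauss_def by (intro prod_nonneg) auto

lemma gauss_measurable [measurable]: "gauss s \<in> borel_measurable borel"
  unfolding gauss_def by measurable

lemma norm_power2_eq_sum_Basis: "(norm (x::'a::euclidean_space))\<^sup>2 = (\<Sum>b\<in>Basis. (x \<bullet> b)\<^sup>2)"
  by (simp only: power2_norm_eq_inner euclidean_inner[of x x]) (simp add: power2_eq_square)

lemma gauss_eq:
  assumes "0 < s"
  shows "gauss s (x :: 'a::euclidean_space) = (1 / (s * sqrt (2 * pi))) ^ DIM('a) * exp (- (norm x)\<^sup>2 / (2 * s\<^sup>2))"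
proof -
  have "gauss s x = (\<Prod>b\<in>(Basis::'a set). (1 / (s * sqrt (2 * pi))) * exp (- (x \<bullet> b)\<^sup>2 / (2 * s\<^sup>2)))"
    unfolding gauss_def normal_density_def using assms
    by (intro prod.cong) (auto simp: real_sqrt_mult field_simps)
  also have "\<dots> = (1 / (s * sqrt (2 * pi))) ^ DIM('a) * exp (\<Sum>b\<in>(Basis::'a set). - (x \<bullet> b)\<^sup>2 / (2 * s\<^sup>2))"
    unfolding prod.distrib by (simp add: exp_sum)
  also have "(\<Sum>b\<in>(Basis::'a set). - (x \<bullet> b)\<^sup>2 / (2 * s\<^sup>2)) = - (norm x)\<^sup>2 / (2 * s\<^sup>2)"
    by (simp add: norm_power2_eq_sum_Basis sum_negf sum_divide_distrib)
  finally show ?thesis .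
qed

text \<open>Both the density and the character factor over coordinates, so the one-dimensional
  transforms multiply.\<close>

lemma integral_gauss_exp:
  fixes x :: "'a::euclidean_space"
  assumes "0 < s"
  shows "integrable lborel (\<lambda>z. complex_of_real (gauss s z) * iexp (x \<bullet> z))"
    and "(LINT z|lborel. complex_of_real (gauss s z) * iexp (x \<bullet> z)) = of_real (exp (- (s * norm x)\<^sup>2 / 2))"
proof -
  have eq: "complex_of_real (gauss s z) * iexp (x \<bullet> z)
      = (\<Prod>b\<in>Basis. complex_of_real (normal_density 0 s (z \<bullet> b)) * iexp ((x \<bullet> b) * (z \<bullet> b)))" for z
    by (simp add: gauss_def prod.distrib exp_sum[symmetric] sum_distrib_left[symmetric]
          euclidean_inner[of x z])
  show "integrable lborel (\<lambda>z. complex_of_real (gauss s z) * iexp (x \<bullet> z))"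
    unfolding eq by (intro lborel_integral_prod(1) char_normal_density assms)
  have "(LINT z|lborel. complex_of_real (gauss s z) * iexp (x \<bullet> z))
      = (\<Prod>b\<in>(Basis::'a set). of_real (exp (- (s * (x \<bullet> b))\<^sup>2 / 2)))"
    unfolding eq
    by (subst lborel_integral_prod(2))
       (auto simp only: char_normal_density[OF assms] intro!: prod.cong)
  also have "\<dots> = of_real (exp (\<Sum>b\<in>(Basis::'a set). - (s * (x \<bullet> b))\<^sup>2 / 2))"
    by (simp add: exp_sum)
  also have "(\<Sum>b\<in>(Basis::'a set). - (s * (x \<bullet> b))\<^sup>2 / 2) = - (s * norm x)\<^sup>2 / 2"
    by (simp add: power_mult_distrib norm_power2_eq_sum_Basis sum_negf sum_divide_distrib sum_distrib_left)
  finally show "(LINT z|lborel. complex_of_real (gauss s z) * iexp (x \<bullet> z)) = of_real (exp (- (s * norm x)\<^sup>2 / 2))" .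
qed

text \<open>The total mass is the value of the transform just computed at frequency 0.\<close>

lemma prob_space_gauss: "0 < s \<Longrightarrow> prob_space (density lborel (gauss s :: 'a::euclidean_space \<Rightarrow> real))"
proof
  assume s: "0 < s"
  have i: "integrable lborel (\<lambda>z::'a. complex_of_real (gauss s z))"
    using integral_gauss_exp(1)[OF s, of 0] by simp
  have "(LINT z|lborel. complex_of_real (gauss s (z::'a))) = 1"
    using integral_gauss_exp(2)[OF s, of "0::'a"] by simp
  then have "(LINT z|lborel. gauss s (z::'a)) = 1"
    by simp
  moreover have "integrable lborel (gauss s :: 'a \<Rightarrow> real)"
    using i by (simp add: complex_of_real_integrable_eq)
  ultimately show "emeasure (density lborel (gauss s :: 'a \<Rightarrow> real)) (space (density lborel (gauss s))) = 1"
    by (simp add: emeasure_density nn_integral_eq_integral)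
qed

text \<open>The transform of a Gaussian of width s is an unnormalised Gaussian of width 1 / s; the
  prefactor is its total integral.\<close>

lemma gauss_dual:
  fixes x :: "'a::euclidean_space"
  assumes s: "0 < s"
  shows "exp (- (s * norm x)\<^sup>2 / 2) = (sqrt (2 * pi) / s) ^ DIM('a) * gauss (1 / s) x"
proof -
  have "(sqrt (2 * pi) / s) ^ DIM('a) * (1 / (1 / s * sqrt (2 * pi))) ^ DIM('a) = 1"
    unfolding power_mult_distrib[symmetric] using s by simp
  then show ?thesis
    using s by (simp add: gauss_eq power_mult_distrib power_divide mult.assoc[symmetric])
qed

text \<open>Enlarging A to the whole space removes the dependence on A, translation invariance
  removes x, and \<open>gauss_dual\<close> evaluates the remaining integral.\<close>

lemma exp_gauss_integral_le:
  fixes x :: "'a::euclidean_space"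
  assumes s: "0 < s" and A: "A \<in> sets borel"
  shows "(LINT y|density lborel (\<lambda>y. ennreal (indicator A y)). exp (- (s * norm (y - x))\<^sup>2 / 2)) \<le> (sqrt (2 * pi) / s) ^ DIM('a)"
proof -
  define h :: "'a \<Rightarrow> real" where "h y = exp (- (s * norm y)\<^sup>2 / 2)" for y
  have h: "h y = (sqrt (2 * pi) / s) ^ DIM('a) * gauss (1 / s) y" for y
    unfolding h_def using gauss_dual[OF s] .
  have [measurable]: "h \<in> borel_measurable borel"
    unfolding h_def by measurable
  note [measurable] = A
  interpret P: prob_space "density lborel (gauss (1 / s) :: 'a \<Rightarrow> real)"
    using s by (intro prob_space_gauss) simp
  have ig: "integrable lborel (gauss (1 / s) :: 'a \<Rightarrow> real)"
    using P.integrable_const[of "1::real"] by (subst (asm) integrable_density) auto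
  have "(LINT z|lborel. gauss (1 / s) (z::'a)) = 1"
    using P.prob_space by (simp add: emeasure_density measure_def integral_eq_nn_integral ig)
  then have h1: "(LINT y|lborel. h y) = (sqrt (2 * pi) / s) ^ DIM('a)"
    unfolding h by simp
  have ih: "integrable lborel h"
    unfolding h using ig by simp
  have eq: "distr lborel borel ((+) (- x)) = (lborel :: 'a measure)"
    by (rule lborel_distr_plus)
  have ih': "integrable lborel (\<lambda>y. h (y - x))"
    using integrable_distr[of "(+) (- x)" lborel borel h] ih by (simp add: eq)
  have "(LINT y|lborel. h (y - x)) = (LINT y|lborel. h y)"
    using integral_distr[of "(+) (- x)" lborel borel h] by (simp add: eq)
  moreover have "(LINT y|density lborel (\<lambda>y. ennreal (indicator A y)). h (y - x)) = (LINT y|lborel. indicator A y * h (y - x))"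
    by (subst integral_density) auto
  moreover have "(LINT y|lborel. indicator A y * h (y - x)) \<le> (LINT y|lborel. h (y - x))"
    using ih' integrable_real_mult_indicator[OF _ ih', of A]
    by (intro integral_mono) (simp_all add: mult.commute indicator_def h_def)
  ultimately show ?thesis
    using h1 unfolding h_def by simp
qed

text \<open>
  By Fubini, the integral of the squared transform against a Gaussian is the double integral over
  \<open>A \<times> A\<close> of the dual Gaussian of \<open>y - x\<close>, which is integrable in \<open>y\<close> over the whole space.
\<close>

lemma fourier_indicator_L2:
  fixes A :: "'a::euclidean_space set"
  assumes s: "0 < s" and A[measurable]: "A \<in> sets borel" and fin: "emeasure lborel A < \<infinity>"
  defines "\<phi> \<equiv> \<lambda>z. LINT x|lborel. indicator A x * exp (- (\<i> * complex_of_real (x \<bullet> z)))"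
  shows "\<phi> \<in> borel_measurable borel"
    and "integrable (density lborel (gauss s)) (\<lambda>z. (cmod (\<phi> z))\<^sup>2)"
    and "(LINT z|density lborel (gauss s). (cmod (\<phi> z))\<^sup>2) \<le> (sqrt (2 * pi) / s) ^ DIM('a) * measure lborel A"
proof -
  \<comment> \<open>Lebesgue measure restricted to A is finite, so bounded measurable functions are
    integrable on all the products below and Fubini applies.\<close>
  define N where "N = density lborel (\<lambda>x. ennreal (indicator A x :: real))"
  define G where "G = density lborel (gauss s :: 'a \<Rightarrow> real)"
  have [measurable_cong, simp]: "sets N = sets borel" "sets G = sets borel"
    and [simp]: "space N = UNIV" "space G = UNIV"
    by (simp_all add: N_def G_def)
  have emN: "emeasure N UNIV = emeasure lborel A"
    unfolding N_def by (subst emeasure_density) (auto simp: ennreal_indicator)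
  interpret N: finite_measure N
    using fin by (intro finite_measureI) (simp add: emN)
  interpret G: prob_space G
    unfolding G_def by (rule prob_space_gauss[OF s])
  interpret NN: pair_sigma_finite N N ..
  interpret NN': finite_measure "N \<Otimes>\<^sub>M N"
    by (intro finite_measure_pair_measure N.finite_measure_axioms)
  interpret NG: pair_sigma_finite "N \<Otimes>\<^sub>M N" G ..
  interpret NG': finite_measure "(N \<Otimes>\<^sub>M N) \<Otimes>\<^sub>M G"
    by (intro finite_measure_pair_measure NN'.finite_measure_axioms G.finite_measure_axioms)
  show m[measurable]: "\<phi> \<in> borel_measurable borel"
    unfolding \<phi>_def by measurable
  have \<phi>: "\<phi> z = (LINT x|N. iexp (- (x \<bullet> z)))" for z
    unfolding \<phi>_def N_def by (subst integral_density) (auto simp: scaleR_conv_of_real of_real_indicator)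
  have b: "cmod (\<phi> z) \<le> measure lborel A" for z
  proof -
    have "cmod (\<phi> z) \<le> (LINT x|N. cmod (iexp (- (x \<bullet> z))))"
      unfolding \<phi> by (rule integral_norm_bound)
    also have "\<dots> = measure lborel A"
      by (simp add: measure_def emN)
    finally show ?thesis .
  qed
  show i: "integrable (density lborel (gauss s)) (\<lambda>z. (cmod (\<phi> z))\<^sup>2)"
    unfolding G_def[symmetric]
    by (rule G.integrable_const_bound[of _ "(measure lborel A)\<^sup>2"]) (auto intro!: power_mono b)
  \<comment> \<open>The square is \<phi> times its conjugate, hence a double integral of the
    character of frequency y - x. Integrating in z first then produces the transform of the Gaussian
    at y - x.\<close>
  have sq: "complex_of_real ((cmod (\<phi> z))\<^sup>2) = (LINT p|(N \<Otimes>\<^sub>M N). iexp ((snd p - fst p) \<bullet> z))" for z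
  proof -
    have "complex_of_real ((cmod (\<phi> z))\<^sup>2) = \<phi> z * cnj (\<phi> z)"
      by (rule complex_norm_square)
    also have "cnj (\<phi> z) = (LINT y|N. iexp (y \<bullet> z))"
      unfolding \<phi> using Bochner_Integration.integral_cnj[where M = N and f = "\<lambda>x. iexp (- (x \<bullet> z))"]
      by (simp add: exp_cnj del: Bochner_Integration.integral_cnj)
    also have "\<phi> z * (LINT y|N. iexp (y \<bullet> z)) = (LINT x|N. LINT y|N. iexp (- (x \<bullet> z)) * iexp (y \<bullet> z))"
      unfolding \<phi> by simp
    also have "\<dots> = (LINT x|N. LINT y|N. iexp ((y - x) \<bullet> z))"
      by (simp add: exp_add[symmetric] inner_diff_left algebra_simps)
    also have "\<dots> = (LINT p|(N \<Otimes>\<^sub>M N). iexp ((snd p - fst p) \<bullet> z))"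
      by (subst NN.integral_fst'[symmetric]) (auto intro!: NN'.integrable_const_bound[of _ 1])
    finally show ?thesis .
  qed
  have "complex_of_real (LINT z|G. (cmod (\<phi> z))\<^sup>2) = (LINT z|G. LINT p|(N \<Otimes>\<^sub>M N). iexp ((snd p - fst p) \<bullet> z))"
    unfolding integral_complex_of_real[symmetric] sq ..
  also have "\<dots> = (LINT p|(N \<Otimes>\<^sub>M N). LINT z|G. iexp ((snd p - fst p) \<bullet> z))"
    by (rule NG.Fubini_integral) (auto intro!: NG'.integrable_const_bound[of _ 1] simp: split_beta)
  also have "\<dots> = (LINT p|(N \<Otimes>\<^sub>M N). of_real (exp (- (s * norm (snd p - fst p))\<^sup>2 / 2)))"
    unfolding G_def
    by (subst integral_density) (auto simp: integral_gauss_exp[OF s] scaleR_conv_of_real)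
  also have "\<dots> = of_real (LINT p|(N \<Otimes>\<^sub>M N). (exp (- (s * norm (snd p - fst p))\<^sup>2 / 2)))"
    by (rule integral_complex_of_real)
  finally have "(LINT z|G. (cmod (\<phi> z))\<^sup>2) = (LINT p|(N \<Otimes>\<^sub>M N). (exp (- (s * norm (snd p - fst p))\<^sup>2 / 2)))"
    using of_real_eq_iff by blast
  also have "\<dots> = (LINT x|N. LINT y|N. (exp (- (s * norm (y - x))\<^sup>2 / 2)))"
    by (subst NN.integral_fst'[symmetric]) (auto intro!: NN'.integrable_const_bound[of _ 1])
  also have "\<dots> \<le> (LINT x|N. (sqrt (2 * pi) / s) ^ DIM('a))"
  proof (rule integral_mono)
    show "(LINT y|N. exp (- (s * norm (y - x))\<^sup>2 / 2)) \<le> (sqrt (2 * pi) / s) ^ DIM('a)" for x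
      unfolding N_def by (rule exp_gauss_integral_le[OF s A])
    show "integrable N (\<lambda>x. LINT y|N. exp (- (s * norm (y - x))\<^sup>2 / 2))"
    proof (rule N.integrable_const_bound[of _ "(sqrt (2 * pi) / s) ^ DIM('a)"])
      show "AE x in N. norm (LINT y|N. exp (- (s * norm (y - x))\<^sup>2 / 2)) \<le> (sqrt (2 * pi) / s) ^ DIM('a)"
        using exp_gauss_integral_le[OF s A] unfolding N_def[symmetric]
        by (intro AE_I2) (simp add: integral_nonneg)
    qed measurable
  qed simp
  also have "\<dots> = (sqrt (2 * pi) / s) ^ DIM('a) * measure lborel A"
    by (simp add: measure_def emN)
  finally show "(LINT z|density lborel (gauss s). (cmod (\<phi> z))\<^sup>2) \<le> (sqrt (2 * pi) / s) ^ DIM('a) * measure lborel A"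
    unfolding G_def .
qed

text \<open>Chebyshev's inequality against a Gaussian whose width s is a radius of a ball containing
  E. There the density is at least a fixed multiple of s^-n, which matches the factor s^-n of the
  Gaussian-weighted L2 bound.\<close>

lemma fourier_indicator_level_borel:
  fixes A E :: "'a::euclidean_space set"
  assumes A: "A \<in> sets borel" and fin: "emeasure lborel A < \<infinity>"
    and E[measurable]: "E \<in> sets borel" and bE: "bounded E" and \<alpha>: "0 < \<alpha>"
    and le: "\<And>z. z \<in> E \<Longrightarrow> \<alpha> \<le> cmod (LINT x|lborel. indicator A x * exp (- (\<i> * complex_of_real (x \<bullet> z))))"
  shows "\<alpha>\<^sup>2 * measure lborel E \<le> exp (1 / 2) * (2 * pi) ^ DIM('a) * measure lborel A"
proof -
  obtain s where s: "0 < s" and Es: "\<And>z. z \<in> E \<Longrightarrow> norm z \<le> s"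
    using bE by (auto simp: bounded_pos)
  define \<phi> where "\<phi> z = (LINT x|lborel. indicator A x * exp (- (\<i> * complex_of_real (x \<bullet> z))))" for z
  note L2 = fourier_indicator_L2[OF s A fin, folded \<phi>_def]
  define G where "G = density lborel (gauss s :: 'a \<Rightarrow> real)"
  interpret G: prob_space G
    unfolding G_def by (rule prob_space_gauss[OF s])
  have finE: "emeasure lborel E < \<infinity>"
    using bE by (rule emeasure_bounded_finite)
  \<comment> \<open>The density at distance s from the origin, hence its minimum over the ball of
    radius s.\<close>
  define c where "c = (1 / (s * sqrt (2 * pi))) ^ DIM('a) * exp (- (1 / 2))"
  have c: "c \<le> gauss s z" if "z \<in> E" for z
  proof -
    have "(norm z)\<^sup>2 \<le> s\<^sup>2"
      using Es[OF that] by (intro power_mono) auto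
    then have "- (1 / 2) \<le> - (norm z)\<^sup>2 / (2 * s\<^sup>2)"
      using s by (simp add: field_simps)
    then show ?thesis
      unfolding c_def gauss_eq[OF s] using s by (intro mult_left_mono) auto
  qed
  have c0: "0 < c"
    unfolding c_def using s by simp
  have "ennreal c * emeasure lborel E = (\<integral>\<^sup>+x. ennreal c * indicator E x \<partial>lborel)"
    by (simp add: nn_integral_cmult_indicator)
  also have "\<dots> \<le> emeasure G E"
    unfolding G_def
    by (subst emeasure_density) (auto intro!: nn_integral_mono ennreal_leI c simp: indicator_def)
  finally have "ennreal (c * measure lborel E) \<le> ennreal (measure G E)"
    using finE c0 by (simp add: G.emeasure_eq_measure emeasure_eq_ennreal_measure ennreal_mult)
  then have cE: "c * measure lborel E \<le> measure G E"
    by simp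
  have "\<alpha>\<^sup>2 * measure G E = (LINT z|G. \<alpha>\<^sup>2 * indicator E z)"
    by (simp add: G_def)
  also have "\<dots> \<le> (LINT z|G. (cmod (\<phi> z))\<^sup>2)"
  proof (rule integral_mono)
    show "integrable G (\<lambda>z. (cmod (\<phi> z))\<^sup>2)"
      unfolding G_def by (rule L2)
    show "integrable G (\<lambda>z. \<alpha>\<^sup>2 * indicator E z)"
      by (rule G.integrable_const_bound[of _ "\<alpha>\<^sup>2"]) (auto simp: indicator_def G_def)
    show "\<alpha>\<^sup>2 * indicator E z \<le> (cmod (\<phi> z))\<^sup>2" for z
      using le[of z] \<alpha> by (auto simp: indicator_def \<phi>_def intro!: power_mono)
  qed
  also have "\<dots> \<le> (sqrt (2 * pi) / s) ^ DIM('a) * measure lborel A"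
    unfolding G_def by (rule L2)
  finally have "\<alpha>\<^sup>2 * (c * measure lborel E) \<le> (sqrt (2 * pi) / s) ^ DIM('a) * measure lborel A"
    using mult_left_mono[OF cE, of "\<alpha>\<^sup>2"] by simp
  then have "(\<alpha>\<^sup>2 * measure lborel E) * c \<le> (sqrt (2 * pi) / s) ^ DIM('a) * measure lborel A"
    by (simp only: mult_ac)
  from pos_le_divide_eq[OF c0, THEN iffD2, OF this]
  have "\<alpha>\<^sup>2 * measure lborel E \<le> ((sqrt (2 * pi) / s) ^ DIM('a) / c) * measure lborel A"
    by simp
  \<comment> \<open>The powers of s cancel, so the constant does not depend on the extent of
    E.\<close>
  also have "(sqrt (2 * pi) / s) ^ DIM('a) / c = exp (1 / 2) * ((sqrt (2 * pi) / s) * (s * sqrt (2 * pi))) ^ DIM('a)"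
    unfolding c_def power_mult_distrib by (simp add: exp_minus field_simps)
  also have "(sqrt (2 * pi) / s) * (s * sqrt (2 * pi)) = 2 * pi"
    using s by simp
  finally show ?thesis .
qed

section \<open>Passage from Borel to Lebesgue measurable sets\<close>

lemma lebesgue_set_borel_core:
  assumes "S \<in> sets lebesgue"
  obtains B where "B \<in> sets borel" "B \<subseteq> S" "S - B \<in> null_sets lebesgue"
proof -
  obtain B N N' where "S = B \<union> N" "N \<subseteq> N'" "N' \<in> null_sets lborel" "B \<in> sets lborel"
    using assms by (rule sets_completionE)
  moreover from this have "S - B \<in> null_sets lebesgue"
    using null_sets_completion_subset[OF _ null_sets_completionI, of "S - B" N' lborel] by blast
  ultimately have "S - B \<in> null_sets lebesgue" and "B \<subseteq> S" and "B \<in> sets borel"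
    by auto
  then show thesis
    by (intro that)
qed

lemma measure_borel_core:
  assumes "B \<in> sets borel" "B \<subseteq> S" "S - B \<in> null_sets lebesgue"
  shows "S \<in> sets lebesgue" and "emeasure lebesgue S = emeasure lborel B" and "measure lebesgue S = measure lborel B"
proof -
  have S: "S = B \<union> (S - B)" and B: "B \<in> sets lebesgue"
    using assms by auto
  show "S \<in> sets lebesgue"
    by (subst S) (use assms B in blast)
  show e: "emeasure lebesgue S = emeasure lborel B"
    by (subst S, subst emeasure_Un_null_set[OF B assms(3)]) (use assms in simp)
  show "measure lebesgue S = measure lborel B"
    by (simp add: measure_def e)
qed

lemma fourier_indicator_borel_core:
  fixes B :: "(real^'n) set"
  assumes "B \<in> sets borel" "B \<subseteq> S" "S - B \<in> null_sets lebesgue"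
  shows "fourier (indicator S) z = (LINT x|lborel. indicator B x * exp (- (\<i> * complex_of_real (x \<bullet> z))))"
proof -
  note [measurable] = assms(1)
  have [measurable]: "S \<in> sets lebesgue" "B \<in> sets lebesgue"
    using measure_borel_core[OF assms] assms(1) by auto
  have m: "(\<lambda>x. exp (- (\<i> * complex_of_real (x \<bullet> z)))) \<in> borel_measurable lebesgue"
    by (rule measurable_completion) measurable
  have "fourier (indicator S) z = (LINT x|lebesgue. indicator B x * exp (- (\<i> * complex_of_real (x \<bullet> z))))"
    unfolding fourier_def
  proof (rule integral_cong_AE)
    show "AE x in lebesgue. indicator S x * exp (- (\<i> * complex_of_real (x \<bullet> z))) = indicator B x * exp (- (\<i> * complex_of_real (x \<bullet> z)))"
      using AE_not_in[OF assms(3)] by eventually_elim (use assms(2) in \<open>auto simp: indicator_def\<close>)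
  qed (use m in measurable)
  also have "\<dots> = (LINT x|lborel. indicator B x * exp (- (\<i> * complex_of_real (x \<bullet> z))))"
    by (rule integral_completion) measurable
  finally show ?thesis .
qed

lemma integrable_fourier_indicator:
  assumes "A \<in> lmeasurable"
  shows "integrable lebesgue (\<lambda>x. indicator A x * exp (- (\<i> * complex_of_real (x \<bullet> z))))"
proof -
  have m: "(\<lambda>x. exp (- (\<i> * complex_of_real (x \<bullet> z)))) \<in> borel_measurable lebesgue"
    by (rule measurable_completion) measurable
  have [measurable]: "A \<in> sets lebesgue"
    using assms by auto
  have "integrable lebesgue (indicator A :: _ \<Rightarrow> real)"
    using assms by (simp add: fmeasurable_def)
  then show ?thesis
    by (rule Bochner_Integration.integrable_bound) (use m in \<open>auto simp: norm_mult indicator_def\<close>)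
qed

lemma fourier_indicator_measurable:
  assumes "A \<in> lmeasurable"
  shows "fourier (indicator A) \<in> borel_measurable borel"
proof -
  have "A \<in> sets lebesgue"
    using assms by auto
  then obtain B where B: "B \<in> sets borel" "B \<subseteq> A" "A - B \<in> null_sets lebesgue"
    by (rule lebesgue_set_borel_core)
  note [measurable] = B(1)
  \<comment> \<open>Over the Borel core the transform is a parameter integral against
    \<open>lborel\<close>, measurable in the parameter.\<close>
  show ?thesis
    unfolding fourier_indicator_borel_core[OF B, abs_def] by measurable
qed

lemma norm_fourier_indicator_le:
  assumes "A \<in> lmeasurable"
  shows "cmod (fourier (indicator A) z) \<le> measure lebesgue A"
proof -
  have "cmod (fourier (indicator A) z) \<le> (LINT x|lebesgue. cmod (indicator A x * exp (- (\<i> * complex_of_real (x \<bullet> z)))))"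
    unfolding fourier_def by (rule integral_norm_bound)
  also have "\<dots> = (LINT x|lebesgue. indicator A x)"
    by (intro Bochner_Integration.integral_cong) (auto simp: norm_mult indicator_def)
  finally show ?thesis
    using assms by simp
qed

lemma fourier_indicator_diff:
  assumes "A \<in> lmeasurable" "B \<in> lmeasurable" "A \<subseteq> B"
  shows "fourier (indicator B) z - fourier (indicator A) z = fourier (indicator (B - A)) z"
proof -
  have eq: "indicator (B - A) x * c = indicator B x * c - indicator A x * c" for x and c :: complex
    using assms(3) by (auto simp: indicator_def)
  show ?thesis
    unfolding fourier_def eq using assms(1,2)
    by (subst Bochner_Integration.integral_diff) (simp_all only: integrable_fourier_indicator)
qed

lemma fourier_indicator_level_L2:
  fixes A E :: "(real^'n) set"
  assumes A: "A \<in> lmeasurable" and E: "E \<in> sets lebesgue" and bE: "bounded E" and \<alpha>: "0 < \<alpha>"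
    and le: "\<And>z. z \<in> E \<Longrightarrow> \<alpha> \<le> cmod (fourier (indicator A) z)"
  shows "\<alpha>\<^sup>2 * measure lebesgue E \<le> exp (1 / 2) * (2 * pi) ^ CARD('n) * measure lebesgue A"
proof -
  obtain B where B: "B \<in> sets borel" "B \<subseteq> A" "A - B \<in> null_sets lebesgue"
    using fmeasurableD[OF A] by (rule lebesgue_set_borel_core)
  obtain D where D: "D \<in> sets borel" "D \<subseteq> E" "E - D \<in> null_sets lebesgue"
    using E by (rule lebesgue_set_borel_core)
  have "\<alpha>\<^sup>2 * measure lborel D \<le> exp (1 / 2) * (2 * pi) ^ DIM(real^'n) * measure lborel B"
  proof (rule fourier_indicator_level_borel[OF B(1) _ D(1) _ \<alpha>])
    show "emeasure lborel B < \<infinity>"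
      using A measure_borel_core(2)[OF B] by (simp add: fmeasurable_def)
    show "bounded D"
      using bE D(2) by (rule bounded_subset)
  qed (use le D(2) in \<open>auto simp: fourier_indicator_borel_core[OF B]\<close>)
  then show ?thesis
    by (simp add: measure_borel_core(3)[OF B] measure_borel_core(3)[OF D])
qed

text \<open>Split \<alpha>^s into \<alpha>^(s-2) and \<alpha>^2. The L2 bound handles the second
  factor; if E is nonempty, the trivial bound gives \<alpha> \<le> |A|, so the first is at most
  |A|^(s-2) because s is at least 2.\<close>

lemma fourier_indicator_level:
  fixes A E :: "(real^'n) set"
  assumes A: "A \<in> lmeasurable" and E: "E \<in> sets lebesgue" and bE: "bounded E" and \<alpha>: "0 < \<alpha>"
    and le: "\<And>z. z \<in> E \<Longrightarrow> \<alpha> \<le> cmod (fourier (indicator A) z)" and s: "2 \<le> s"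
  shows "\<alpha> powr s * measure lebesgue E \<le> exp (1 / 2) * (2 * pi) ^ CARD('n) * measure lebesgue A powr (s - 1)"
proof (cases "E = {}")
  case False
  then obtain z where "z \<in> E"
    by auto
  then have \<alpha>A: "\<alpha> \<le> measure lebesgue A"
    using le norm_fourier_indicator_le[OF A] order_trans by blast
  have "\<alpha> powr s * measure lebesgue E = \<alpha> powr (s - 2) * (\<alpha>\<^sup>2 * measure lebesgue E)"
    using \<alpha> powr_add[of \<alpha> "s - 2" 2] by simp
  also have "\<dots> \<le> measure lebesgue A powr (s - 2) * (exp (1 / 2) * (2 * pi) ^ CARD('n) * measure lebesgue A)"
    using \<alpha> \<alpha>A s by (intro mult_mono powr_mono2 fourier_indicator_level_L2[OF A E bE \<alpha> le]) auto
  also have "\<dots> = exp (1 / 2) * (2 * pi) ^ CARD('n) * measure lebesgue A powr (s - 1)"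
    using \<alpha> \<alpha>A powr_add[of "measure lebesgue A" "s - 2" 1] by (simp add: algebra_simps)
  finally show ?thesis .
qed simp

section \<open>Cubes\<close>

lemma emass_eq_emeasure:
  assumes "f \<in> borel_measurable lebesgue" "E \<in> sets lebesgue"
  shows "emass f E = emeasure (density lebesgue f) E"
  using assms by (simp add: emass_def emeasure_density)

lemma emass_mono:
  assumes "A \<subseteq> B"
  shows "emass f A \<le> emass f B"
  unfolding emass_def using assms by (intro nn_integral_mono mult_left_mono) (auto simp: indicator_def)

lemma locally_integrable_measurable: "locally_integrable f \<Longrightarrow> f \<in> borel_measurable lebesgue"
  by (simp add: locally_integrable_def)

lemma locally_integrable_bounded_finite:
  fixes f :: "real^'n \<Rightarrow> ennreal"
  assumes "locally_integrable f" "bounded E"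
  shows "emass f E < \<infinity>"
proof -
  have "emass f E \<le> emass f (closure E)"
    by (intro emass_mono closure_subset)
  also have "\<dots> < \<infinity>"
    using assms by (simp add: locally_integrable_def compact_eq_bounded_closed bounded_closure)
  finally show ?thesis .
qed

definition cube :: "real^'n \<Rightarrow> real \<Rightarrow> (real^'n) set" where
  "cube a l = cbox a (a + (\<chi> i. l))"

lemma cube_sets [simp]: "cube a l \<in> sets lebesgue" "bounded (cube a l)" "cube a l \<in> lmeasurable"
  unfolding cube_def by auto

lemma cube_in_cubes: "0 < l \<Longrightarrow> cube a l \<in> cubes"
  unfolding cubes_def cube_def by auto

lemma mem_cube: "x \<in> cube a l \<longleftrightarrow> (\<forall>i. a $ i \<le> x $ i \<and> x $ i \<le> a $ i + l)"
  unfolding cube_def by (simp add: mem_box_cart)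

lemma measure_cube:
  assumes "0 \<le> l"
  shows "measure lebesgue (cube (a :: real^'n) l) = l ^ CARD('n)"
proof -
  have "cube a l \<noteq> {}"
    using assms by (auto simp: cube_def interval_eq_empty_cart not_less)
  then have "measure lborel (cube a l) = (\<Prod>i\<in>(UNIV::'n set). (a + (\<chi> i. l)) $ i - a $ i)"
    unfolding cube_def by (intro content_cbox_cart)
  then show ?thesis
    by (simp add: cube_def)
qed

lemma emeasure_cube: "0 \<le> l \<Longrightarrow> emeasure lebesgue (cube (a :: real^'n) l) = ennreal (l ^ CARD('n))"
  using measure_cube[of l a] by (metis cube_sets(3) emeasure_eq_measure2)

text \<open>Every side from L on is covered, because the side of the large cube will be prescribed
  by that of the small dual cube.\<close>

lemma bounded_subset_cube:
  fixes E :: "(real^'n) set"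
  assumes "bounded E"
  obtains L where "0 < L" "\<And>l. L \<le> l \<Longrightarrow> \<exists>a. E \<subseteq> cube a l"
proof -
  obtain M where M: "0 < M" "\<And>x. x \<in> E \<Longrightarrow> norm x \<le> M"
    using assms by (auto simp: bounded_pos)
  have "E \<subseteq> cube (\<chi> i. - M) l" if "2 * M \<le> l" for l
  proof
    fix x assume x: "x \<in> E"
    have "\<bar>x $ i\<bar> \<le> M" for i
      using component_le_norm_cart[of x i] M(2)[OF x] by linarith
    then show "x \<in> cube (\<chi> i. - M) l"
      using that unfolding mem_cube vec_lambda_beta by (smt (verit))
  qed
  then show thesis
    using M(1) by (intro that[of "2 * M"]) auto
qed

text \<open>A decomposition into small dyadic cubes, as a substitute for the Lebesgue differentiation theorem.\<close>

lemma emass_le_of_small_cubes: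
  fixes f :: "real^'n \<Rightarrow> ennreal"
  assumes f: "f \<in> borel_measurable lebesgue" and \<delta>: "0 < \<delta>" and K: "0 \<le> K"
    and le: "\<And>a l. 0 < l \<Longrightarrow> l \<le> \<delta> \<Longrightarrow> emass f (cube a l) \<le> ennreal K * emeasure lebesgue (cube a l)"
    and F: "F \<in> sets lebesgue" "bounded F"
  shows "emass f F \<le> ennreal K * emeasure lebesgue F"
proof -
  have fin: "emeasure lebesgue F < \<infinity>"
    using bounded_set_imp_lmeasurable[OF F(2,1)] by (auto simp: fmeasurable_def simp del: emeasure_completion)
  \<comment> \<open>Outer regularity costs an error e in the measure of F, which is sent to 0 at the
    end.\<close>
  have *: "emass f F \<le> ennreal K * (emeasure lebesgue F + ennreal e)" if e: "0 < e" for e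
  proof -
    obtain U where U: "open U" "F \<subseteq> U" "emeasure lebesgue (U - F) < ennreal e"
      using sets_lebesgue_outer_open[OF F(1) e] by metis
    obtain L where L: "0 < L" "\<And>l. L \<le> l \<Longrightarrow> \<exists>a. F \<subseteq> cube a l"
      using bounded_subset_cube[OF F(2)] by metis
    then obtain a where a: "F \<subseteq> cube a L"
      by blast
    \<comment> \<open>A gauge for the covering lemma: the cap \<delta> / 2 keeps the covering cubes
      small, and the inclusion in U keeps their total measure below that of U.\<close>
    define r where "r x = (SOME d. 0 < d \<and> d \<le> \<delta> / 2 \<and> (x \<in> U \<longrightarrow> ball x d \<subseteq> U))" for x
    have r: "0 < r x \<and> r x \<le> \<delta> / 2 \<and> (x \<in> U \<longrightarrow> ball x (r x) \<subseteq> U)" for x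
    proof -
      have "\<exists>d. 0 < d \<and> d \<le> \<delta> / 2 \<and> (x \<in> U \<longrightarrow> ball x d \<subseteq> U)"
      proof (cases "x \<in> U")
        case True
        then obtain d where "0 < d" "ball x d \<subseteq> U"
          using U(1) open_contains_ball by blast
        then show ?thesis
          using \<delta> by (intro exI[of _ "min d (\<delta> / 2)"]) auto
      qed (use \<delta> in \<open>auto intro!: exI[of _ "\<delta> / 2"]\<close>)
      then show ?thesis
        unfolding r_def by (rule someI_ex)
    qed
    have g: "gauge (\<lambda>x. ball x (r x))"
      using r by (simp add: gauge_def)
    have box: "box a (a + (\<chi> i. L)) \<noteq> {}"
      using L(1) by (simp add: interval_ne_empty_cart)
    \<comment> \<open>Countably many nonoverlapping dyadic subcubes of the large cube cover F, each
      inside a gauge ball centred at a point of F.\<close>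
    obtain D where D: "countable D" "\<Union>D \<subseteq> cbox a (a + (\<chi> i. L))"
      "\<And>K. K \<in> D \<Longrightarrow> interior K \<noteq> {} \<and> (\<exists>c d. K = cbox c d)"
      "pairwise (\<lambda>A B. interior A \<inter> interior B = {}) D"
      "\<And>K. K \<in> D \<Longrightarrow> \<exists>x \<in> F \<inter> K. K \<subseteq> ball x (r x)"
      "\<And>u v. cbox u v \<in> D \<Longrightarrow> \<exists>n. \<forall>i \<in> Basis. v \<bullet> i - u \<bullet> i = ((a + (\<chi> i. L)) \<bullet> i - a \<bullet> i) / 2^n"
      "F \<subseteq> \<Union>D"
      using covering_lemma[OF a[unfolded cube_def] box g] by blast
    have cu: "\<exists>c l. 0 < l \<and> l \<le> \<delta> \<and> Q = cube c l \<and> Q \<subseteq> U" if Q: "Q \<in> D" for Q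
    proof -
      obtain c d where cd: "Q = cbox c d"
        using D(3)[OF Q] by blast
      obtain n where n: "\<And>i. i \<in> Basis \<Longrightarrow> d \<bullet> i - c \<bullet> i = ((a + (\<chi> i. L)) \<bullet> i - a \<bullet> i) / 2^n"
        using D(6) Q cd by blast
      have dc: "d $ i = c $ i + L / 2 ^ n" for i
        using n[of "axis i 1"] by (simp add: axis_in_Basis_iff inner_axis algebra_simps)
      then have d: "d = c + (\<chi> i. L / 2 ^ n)"
        by (simp add: vec_eq_iff)
      have Qc: "Q = cube c (L / 2 ^ n)"
        by (simp add: cd d cube_def)
      obtain x where x: "x \<in> F" "Q \<subseteq> ball x (r x)"
        using D(5)[OF Q] by blast
      have lp: "0 < L / 2 ^ n"
        using L(1) by simp
      \<comment> \<open>Opposite corners of Q lie in one ball of radius r x, so they are less than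
        \<delta> apart, and any coordinate of their difference is the side of Q;
        \<open>undefined\<close> serves as an arbitrary coordinate.\<close>
      have "c \<in> Q" "d \<in> Q"
        unfolding Qc mem_cube using lp dc by (auto simp: less_imp_le)
      then have "dist c d < 2 * r x"
        using subsetD[OF x(2)] dist_triangle_less_add[of c x "r x" d "r x"] by (simp add: dist_commute)
      then have "norm (d - c) < \<delta>"
        using r[of x] by (simp add: dist_norm norm_minus_commute)
      then have "L / 2 ^ n \<le> \<delta>"
        using component_le_norm_cart[of "d - c" undefined] dc[of undefined] L(1) by simp
      moreover have "Q \<subseteq> U"
        using x r[of x] U(2) by blast
      ultimately show ?thesis
        using Qc lp by blast
    qed
    have fr: "Q - interior Q \<in> null_sets lebesgue" if "Q \<in> D" for Q
    proof -
      have "convex Q" "closed Q"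
        using D(3)[OF that] by (auto simp: convex_box)
      then have "negligible (Q - interior Q)"
        using negligible_convex_frontier[of Q] by (simp add: frontier_def)
      then show ?thesis
        by (simp add: negligible_iff_null_sets)
    qed
    \<comment> \<open>The faces of the cubes are null for Lebesgue measure and for \<nu>. Discarding
      them leaves the disjoint interiors, over which both measures are countably additive.\<close>
    define N where "N = (\<Union>Q\<in>D. Q - interior Q)"
    have N: "N \<in> null_sets lebesgue"
      unfolding N_def using D(1) fr by (rule null_sets_UN')
    define \<nu> where "\<nu> = density lebesgue f"
    have Nn: "N \<in> null_sets \<nu>"
      unfolding \<nu>_def using N absolutely_continuousI_density[OF f] by (auto simp: absolutely_continuous_def)
    have [simp]: "sets \<nu> = sets lebesgue"
      by (simp add: \<nu>_def)
    have int [measurable]: "interior Q \<in> sets lebesgue" for Q :: "(real^'n) set"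
      by simp
    have sI: "(\<Union>Q\<in>D. interior Q) \<in> sets lebesgue"
      using open_UN[of D interior] by auto
    have disj: "disjoint_family_on interior D"
      using D(4) by (auto simp: disjoint_family_on_def pairwise_def)
    have "emass f F = emeasure \<nu> F"
      unfolding \<nu>_def by (rule emass_eq_emeasure[OF f F(1)])
    also have "\<dots> \<le> emeasure \<nu> ((\<Union>Q\<in>D. interior Q) \<union> N)"
    proof (rule emeasure_mono)
      show "F \<subseteq> (\<Union>Q\<in>D. interior Q) \<union> N"
        using D(7) by (auto simp: N_def)
      show "(\<Union>Q\<in>D. interior Q) \<union> N \<in> sets \<nu>"
        using sI null_setsD2[OF N] by (simp add: sets.Un)
    qed
    also have "\<dots> = emeasure \<nu> (\<Union>Q\<in>D. interior Q)"
      using Nn sI by (intro emeasure_Un_null_set) simp_all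
    also have "\<dots> = (\<integral>\<^sup>+Q. emeasure \<nu> (interior Q) \<partial>count_space D)"
      using D(1) disj by (intro emeasure_UN_countable) auto
    also have "\<dots> \<le> (\<integral>\<^sup>+Q. ennreal K * emeasure lebesgue (interior Q) \<partial>count_space D)"
    proof (rule nn_integral_mono)
      fix Q assume "Q \<in> space (count_space D)"
      then have Q: "Q \<in> D"
        by simp
      then obtain c l where cl: "0 < l" "l \<le> \<delta>" "Q = cube c l"
        using cu by blast
      have "emeasure \<nu> (interior Q) \<le> emass f Q"
        using emass_eq_emeasure[OF f int[of Q]] emass_mono[OF interior_subset[of Q], of f] by (simp add: \<nu>_def)
      also have "\<dots> \<le> ennreal K * emeasure lebesgue Q"
        unfolding cl(3) by (rule le[OF cl(1,2)])
      also have "Q = interior Q \<union> (Q - interior Q)"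
        using interior_subset by blast
      then have "emeasure lebesgue Q = emeasure lebesgue (interior Q)"
        using emeasure_Un_null_set[OF int[of Q] fr[OF Q]] by simp
      finally show "emeasure \<nu> (interior Q) \<le> ennreal K * emeasure lebesgue (interior Q)" .
    qed
    also have "\<dots> = ennreal K * emeasure lebesgue (\<Union>Q\<in>D. interior Q)"
      using D(1) disj by (subst emeasure_UN_countable) (auto simp: nn_integral_cmult)
    also have "\<dots> \<le> ennreal K * emeasure lebesgue U"
    proof (intro mult_left_mono emeasure_mono)
      show "(\<Union>Q\<in>D. interior Q) \<subseteq> U"
        using cu interior_subset by blast
    qed (use U(1) in auto)
    also have "U = F \<union> (U - F)"
      using U(2) by blast
    also have "emeasure lebesgue (F \<union> (U - F)) \<le> emeasure lebesgue F + emeasure lebesgue (U - F)"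
      using U(1) F(1) by (intro emeasure_subadditive) auto
    also have "\<dots> \<le> emeasure lebesgue F + ennreal e"
      using U(3) by (intro add_left_mono) auto
    finally show ?thesis
      by (simp add: mult_left_mono)
  qed
  show ?thesis
  proof (rule tendsto_lowerbound)
    have m: "emeasure lebesgue F = ennreal (measure lebesgue F)"
      using fin by (intro emeasure_eq_ennreal_measure) simp
    have "((\<lambda>e. ennreal (K * (measure lebesgue F + e))) \<longlongrightarrow> ennreal (K * (measure lebesgue F + 0))) (at_right 0)"
      by (intro tendsto_ennrealI tendsto_intros)
    then show "((\<lambda>e. ennreal (K * (measure lebesgue F + e))) \<longlongrightarrow> ennreal K * emeasure lebesgue F) (at_right 0)"
      using K by (simp add: m ennreal_mult)
    show "\<forall>\<^sub>F e in at_right 0. emass f F \<le> ennreal (K * (measure lebesgue F + e))"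
      using * K by (auto simp: m ennreal_mult ennreal_plus eventually_at_filter)
  qed simp
qed

section \<open>Weights and their duals\<close>

lemma epowr_ennreal: "0 \<le> x \<Longrightarrow> 0 < r \<Longrightarrow> epowr (ennreal x) r = ennreal (x powr r)"
  by (auto simp: epowr_def)

lemma epowr_ennreal_pos: "0 < x \<Longrightarrow> epowr (ennreal x) r = ennreal (x powr r)"
  by (auto simp: epowr_def)

lemma epowr_mono: "0 < r \<Longrightarrow> x \<le> y \<Longrightarrow> epowr x r \<le> epowr y r"
  by (cases x; cases y) (auto simp: epowr_ennreal epowr_def top_unique intro!: ennreal_leI powr_mono2)

lemma conj_exp_gt1: "1 < r \<Longrightarrow> 1 < conj_exp r"
  by (simp add: conj_exp_def field_simps)

lemma conj_exp_inverse: "1 < r \<Longrightarrow> 1 / conj_exp r = 1 - 1 / r"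
  by (simp add: conj_exp_def field_simps)

lemma conj_exp_conj_exp: "1 < r \<Longrightarrow> conj_exp (conj_exp r) = r"
  by (simp add: conj_exp_def field_simps)

text \<open>\<open>enn2real\<close> sends an infinite mass to 0, so comparisons of these real masses
  call for bounded sets or a finiteness hypothesis.\<close>

definition rmass :: "(real^'n \<Rightarrow> ennreal) \<Rightarrow> (real^'n) set \<Rightarrow> real" where
  "rmass f E = enn2real (emass f E)"

lemma rmass_nonneg [simp]: "0 \<le> rmass f E"
  by (simp add: rmass_def)

lemma emass_eq_rmass:
  assumes "locally_integrable f" "bounded E"
  shows "emass f E = ennreal (rmass f E)"
  using locally_integrable_bounded_finite[OF assms] by (simp add: rmass_def)

lemma rmass_mono:
  assumes "locally_integrable f" "bounded B" "A \<subseteq> B"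
  shows "rmass f A \<le> rmass f B"
  using emass_mono[OF assms(3), of f] assms bounded_subset[of B A]
  by (simp add: emass_eq_rmass)

lemma emeasure_bounded_eq_measure:
  assumes "E \<in> sets lebesgue" "bounded (E :: (real^'n) set)"
  shows "emeasure lebesgue E = ennreal (measure lebesgue E)"
  using bounded_set_imp_lmeasurable[OF assms(2,1)] by (metis emeasure_eq_measure2)

lemma rmass_le_of_small_cubes:
  fixes f :: "real^'n \<Rightarrow> ennreal"
  assumes f: "locally_integrable f" and \<delta>: "0 < \<delta>" and K: "0 \<le> K"
    and le: "\<And>a l. 0 < l \<Longrightarrow> l \<le> \<delta> \<Longrightarrow> rmass f (cube a l) \<le> K * measure lebesgue (cube a l)"
    and F: "F \<in> sets lebesgue" "bounded F"
  shows "rmass f F \<le> K * measure lebesgue F"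
proof -
  have "emass f F \<le> ennreal K * emeasure lebesgue F"
  proof (rule emass_le_of_small_cubes[OF locally_integrable_measurable[OF f] \<delta> K _ F])
    show "emass f (cube a l) \<le> ennreal K * emeasure lebesgue (cube a l)" if "0 < l" "l \<le> \<delta>" for a l
      using le[OF that] K by (simp add: emass_eq_rmass[OF f] emeasure_bounded_eq_measure ennreal_mult[symmetric] del: emeasure_completion)
  qed
  then show ?thesis
    using K by (simp add: emass_eq_rmass[OF f] F emeasure_bounded_eq_measure ennreal_mult[symmetric] del: emeasure_completion)
qed

text \<open>Relative to the centres, coordinates are at most l / 2 and r / 2 in absolute value, so
  each of the n products contributes at most l r / 4 to the inner product. The relation l r = 4 / n
  makes the sum 1.\<close>

lemma cube_subset_polar:
  fixes a b :: "real^'n"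
  assumes l: "0 < l" and r: "0 < r" and lr: "l * r = 4 / CARD('n)"
  shows "cube b r \<subseteq> translate (polar (translate (cube a l) (- (a + (\<chi> i. l / 2))))) (b + (\<chi> i. r / 2))"
proof
  fix y assume y: "y \<in> cube b r"
  define z where "z = y - (b + (\<chi> i. r / 2))"
  have z: "\<bar>z $ i\<bar> \<le> r / 2" for i
    using y[unfolded mem_cube, rule_format, of i] by (auto simp: z_def abs_le_iff field_simps)
  have "\<bar>x \<bullet> z\<bar> \<le> 1" if x: "x \<in> translate (cube a l) (- (a + (\<chi> i. l / 2)))" for x
  proof -
    obtain x' where x': "x' \<in> cube a l" "x = x' - (a + (\<chi> i. l / 2))"
      using x by (auto simp: translate_def)
    have xi: "\<bar>x $ i\<bar> \<le> l / 2" for i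
      using x'(1)[unfolded mem_cube, rule_format, of i] by (auto simp: x'(2) abs_le_iff field_simps)
    have "\<bar>x \<bullet> z\<bar> \<le> (\<Sum>i\<in>UNIV. \<bar>x $ i * z $ i\<bar>)"
      unfolding inner_vec_def inner_real_def by (rule sum_abs)
    also have "\<dots> \<le> (\<Sum>i\<in>(UNIV::'n set). (l / 2) * (r / 2))"
      unfolding abs_mult by (intro sum_mono mult_mono xi z) (use l in auto)
    also have "\<dots> = 1"
      using lr by (simp add: field_simps)
    finally show ?thesis .
  qed
  then have "z \<in> polar (translate (cube a l) (- (a + (\<chi> i. l / 2))))"
    by (simp add: polar_def)
  moreover have "y = z + (b + (\<chi> i. r / 2))"
    by (simp add: z_def)
  ultimately show "y \<in> translate (polar (translate (cube a l) (- (a + (\<chi> i. l / 2))))) (b + (\<chi> i. r / 2))"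
    unfolding translate_def by blast
qed

text \<open>The first inequality of \<open>N_Q\<close>, with -\<mu> the centre of the first cube and
  \<tau> the centre of the second. Since \<tau> is free, the corners a and b are
  independent.\<close>

lemma N_Q_cubes:
  fixes u v :: "real^'n \<Rightarrow> real"
  assumes p: "1 < p" and q: "1 < q" and u: "weight u" and w: "locally_integrable (dual_weight p v)"
    and N: "(u, v) \<in> N_Q p q"
  obtains C where "0 < C" "\<And>a b l r. 0 < l \<Longrightarrow> 0 < r \<Longrightarrow> l * r = 4 / CARD('n) \<Longrightarrow>
     rmass (\<lambda>x. ennreal (u x)) (cube a l) powr (1 / q) * rmass (dual_weight p v) (cube b r) powr (1 / conj_exp p) \<le> C"
proof -
  obtain C :: real where C: "\<And>Q \<mu> \<tau>. Q \<in> cubes \<Longrightarrow> - \<mu> \<in> Q \<Longrightarrow>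
       epowr (mass u Q) (1 / q) * epowr (emass (dual_weight p v) (translate (polar (translate Q \<mu>)) \<tau>)) (1 / conj_exp p) \<le> ennreal C"
    using N unfolding N_Q_def Let_def by blast
  have pq: "0 < 1 / q" "0 < 1 / conj_exp p"
    using conj_exp_gt1[OF p] q by auto
  have ul: "locally_integrable (\<lambda>x. ennreal (u x))"
    using u by (simp add: weight_def)
  have "rmass (\<lambda>x. ennreal (u x)) (cube a l) powr (1 / q) * rmass (dual_weight p v) (cube b r) powr (1 / conj_exp p) \<le> max C 1"
    if lr: "0 < l" "0 < r" "l * r = 4 / CARD('n)" for a b :: "real^'n" and l r
  proof -
    have "epowr (mass u (cube a l)) (1 / q) * epowr (emass (dual_weight p v) (cube b r)) (1 / conj_exp p)
      \<le> epowr (mass u (cube a l)) (1 / q) * epowr (emass (dual_weight p v)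
         (translate (polar (translate (cube a l) (- (a + (\<chi> i. l / 2))))) (b + (\<chi> i. r / 2)))) (1 / conj_exp p)"
      by (intro mult_left_mono epowr_mono pq emass_mono cube_subset_polar lr) auto
    also have "\<dots> \<le> ennreal C"
      by (rule C[OF cube_in_cubes[OF lr(1)]]) (use lr(1) in \<open>auto simp: mem_cube\<close>)
    also have "\<dots> \<le> ennreal (max C 1)"
      by (intro ennreal_leI) auto
    finally show ?thesis
      using pq by (simp add: emass_eq_rmass[OF ul] emass_eq_rmass[OF w] epowr_ennreal ennreal_mult[symmetric] del: max.bounded_iff)
  qed
  then show thesis
    by (intro that[of "max C 1"]) auto
qed

text \<open>Young's inequality for a v(x) and b w(x): their weighted geometric mean is 1 because
  v^(1/p) w^(1/p') = 1 wherever v is positive.\<close>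

lemma dual_weight_young:
  assumes p: "1 < p" and v: "0 \<le> v x" and ab: "0 < a" "0 < b" "a powr (1 / p) * b powr (1 / conj_exp p) = 1"
  shows "1 \<le> ennreal (a / p) * ennreal (v x) + ennreal (b / conj_exp p) * dual_weight p v x"
proof (cases "v x = 0")
  \<comment> \<open>Where v vanishes the dual weight is infinite, and so is the right-hand
    side.\<close>
  case True
  then show ?thesis
    using p ab conj_exp_gt1[OF p]
    by (simp add: dual_weight_def epowr_def ennreal_mult_top divide_less_0_iff)
next
  case False
  with v have v: "0 < v x"
    by simp
  have p': "1 < conj_exp p"
    by (rule conj_exp_gt1[OF p])
  define y where "y = v x powr (- (conj_exp p / p))"
  have w: "dual_weight p v x = ennreal y"
    using v by (simp add: dual_weight_def epowr_ennreal_pos y_def)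
  have y: "0 < y"
    using v by (simp add: y_def)
  have "(a * v x) powr (1 / p) * (b * y) powr (1 / conj_exp p) \<le> (1 / p) * (a * v x) + (1 / conj_exp p) * (b * y)"
    using p p' ab v y conj_exp_inverse[OF p] by (intro Youngs_inequality_0) auto
  moreover have "(a * v x) powr (1 / p) * (b * y) powr (1 / conj_exp p) = (a powr (1 / p) * b powr (1 / conj_exp p)) * (v x powr (1 / p) * y powr (1 / conj_exp p))"
    using ab v y by (simp add: powr_mult)
  moreover have "v x powr (1 / p) * y powr (1 / conj_exp p) = 1"
    using v p' by (simp add: y_def powr_powr powr_add[symmetric])
  ultimately have "1 \<le> a / p * v x + b / conj_exp p * y"
    using ab by simp
  then have "ennreal 1 \<le> ennreal (a / p * v x + b / conj_exp p * y)"
    by (rule ennreal_leI)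
  then show ?thesis
    using p p' ab v y by (simp add: w ennreal_plus ennreal_mult[symmetric])
qed

text \<open>Hoelder's inequality for 1 = v^(1/p) w^(1/p'), obtained by integrating the pointwise
  Young inequality and optimising over a and b.\<close>

lemma measure_le_weights:
  fixes v :: "real^'n \<Rightarrow> real"
  assumes p: "1 < p" and v: "weight v" and w: "locally_integrable (dual_weight p v)"
    and F: "F \<in> sets lebesgue" "bounded F"
  shows "measure lebesgue F \<le> rmass (\<lambda>x. ennreal (v x)) F powr (1 / p) * rmass (dual_weight p v) F powr (1 / conj_exp p)"
proof -
  let ?V = "rmass (\<lambda>x. ennreal (v x)) F" and ?W = "rmass (dual_weight p v) F" and ?p' = "conj_exp p"
  have p': "1 < ?p'"
    by (rule conj_exp_gt1[OF p])
  have vl: "locally_integrable (\<lambda>x. ennreal (v x))"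
    using v by (simp add: weight_def)
  note [measurable] = locally_integrable_measurable[OF vl] locally_integrable_measurable[OF w] F(1)
  have 1: "measure lebesgue F \<le> a / p * ?V + b / ?p' * ?W"
    if ab: "0 < a" "0 < b" "a powr (1 / p) * b powr (1 / ?p') = 1" for a b
  proof -
    have "emeasure lebesgue F = (\<integral>\<^sup>+x. indicator F x \<partial>lebesgue)"
      by simp
    also have "\<dots> \<le> (\<integral>\<^sup>+x. ennreal (a / p) * (ennreal (v x) * indicator F x) + ennreal (b / ?p') * (dual_weight p v x * indicator F x) \<partial>lebesgue)"
      using dual_weight_young[OF p _ ab, of v] v
      by (intro nn_integral_mono) (auto simp: indicator_def weight_def)
    also have "\<dots> = ennreal (a / p) * mass v F + ennreal (b / ?p') * emass (dual_weight p v) F"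
      unfolding emass_def by (subst nn_integral_add) (auto simp: nn_integral_cmult)
    also have "\<dots> = ennreal (a / p * ?V + b / ?p' * ?W)"
      using ab p p'
      by (simp add: emass_eq_rmass[OF vl F(2)] emass_eq_rmass[OF w F(2)] ennreal_mult[symmetric]
          ennreal_plus[symmetric] del: ennreal_plus)
    finally show ?thesis
      using ab p p' by (simp add: emeasure_bounded_eq_measure[OF F] ennreal_plus[symmetric]
          del: emeasure_completion ennreal_plus)
  qed
  \<comment> \<open>Adding e makes both masses positive, so that optimal parameters exist even if a
    mass vanishes; e tends to 0 afterwards.\<close>
  have 2: "measure lebesgue F \<le> (?V + e) powr (1 / p) * (?W + e) powr (1 / ?p')" if e: "0 < e" for e
  proof -
    define V W where "V = ?V + e" and "W = ?W + e"
    have VW: "0 < V" "0 < W" "?V \<le> V" "?W \<le> W"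
      using e by (auto simp: V_def W_def add_nonneg_pos)
    \<comment> \<open>The optimal parameters: they satisfy a V = b W = V^(1/p) W^(1/p'), so the
      convex combination equals this common value.\<close>
    define a b where "a = V powr (- (1 / ?p')) * W powr (1 / ?p')" and "b = V powr (1 / p) * W powr (- (1 / p))"
    have ab: "0 < a" "0 < b"
      using VW by (auto simp: a_def b_def)
    have i: "1 / ?p' = 1 - 1 / p"
      by (rule conj_exp_inverse[OF p])
    have "a powr (1 / p) * b powr (1 / ?p')
        = (V powr (- (1 / ?p') * (1 / p)) * W powr (1 / ?p' * (1 / p))) * (V powr (1 / p * (1 / ?p')) * W powr (- (1 / p) * (1 / ?p')))"
      unfolding a_def b_def using VW by (simp only: powr_mult powr_powr)
    also have "\<dots> = V powr (- (1 / ?p') * (1 / p) + 1 / p * (1 / ?p')) * W powr (1 / ?p' * (1 / p) + - (1 / p) * (1 / ?p'))"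
      by (simp only: powr_add mult_ac)
    also have "\<dots> = 1"
      using VW by (simp add: mult.commute)
    finally have "a powr (1 / p) * b powr (1 / ?p') = 1" .
    from 1[OF ab this] have "measure lebesgue F \<le> a / p * ?V + b / ?p' * ?W" .
    also have "\<dots> \<le> a / p * V + b / ?p' * W"
      using VW ab p p' by (intro add_mono mult_left_mono) auto
    also have "a / p * V = (1 / p) * (V powr (1 / p) * W powr (1 / ?p'))"
    proof -
      have "V powr (1 / p) = V powr (- (1 / ?p')) * V"
        using VW powr_add[of V "- (1 / ?p')" 1] by (simp add: i)
      then show ?thesis
        by (simp add: a_def)
    qed
    also have "b / ?p' * W = (1 / ?p') * (V powr (1 / p) * W powr (1 / ?p'))"
    proof -
      have "W powr (1 / ?p') = W powr (- (1 / p)) * W"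
        using VW powr_add[of W "- (1 / p)" 1] by (simp add: i)
      then show ?thesis
        by (simp add: b_def)
    qed
    also have "(1 / p) * (V powr (1 / p) * W powr (1 / ?p')) + (1 / ?p') * (V powr (1 / p) * W powr (1 / ?p')) = V powr (1 / p) * W powr (1 / ?p')"
      unfolding distrib_right[symmetric] by (simp add: i)
    finally show ?thesis
      unfolding V_def W_def .
  qed
  show ?thesis
  proof (rule tendsto_lowerbound)
    have "((\<lambda>e. (?V + e) powr (1 / p) * (?W + e) powr (1 / ?p')) \<longlongrightarrow> (?V + 0) powr (1 / p) * (?W + 0) powr (1 / ?p')) (at_right 0)"
      using p p' by (intro tendsto_intros tendsto_powr') (auto simp: eventually_at_filter)
    then show "((\<lambda>e. (?V + e) powr (1 / p) * (?W + e) powr (1 / ?p')) \<longlongrightarrow> ?V powr (1 / p) * ?W powr (1 / ?p')) (at_right 0)"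
      by simp
    show "\<forall>\<^sub>F e in at_right 0. measure lebesgue F \<le> (?V + e) powr (1 / p) * (?W + e) powr (1 / ?p')"
      using 2 by (auto simp: eventually_at_filter)
  qed simp
qed

section \<open>Bounds for bounded sets\<close>

text \<open>Positive mass of the cube ensures that the real quotients agree with the extended ones.
  Replacing the constant by its maximum with 1 makes it positive.\<close>

lemma cube_condition_real:
  fixes u v :: "real^'n \<Rightarrow> real"
  assumes p: "1 < p" and q: "1 < q" and u: "weight u" and v: "weight v" and cc: "cube_condition p q u v"
  obtains C where "0 < C"
    "\<And>a l E. 0 < l \<Longrightarrow> E \<in> sets lebesgue \<Longrightarrow> E \<subseteq> cube a l \<Longrightarrow> q \<le> conj_exp p \<Longrightarrow>
       0 < rmass (\<lambda>x. ennreal (u x)) (cube a l) \<Longrightarrow>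
       rmass (\<lambda>x. ennreal (u x)) E / rmass (\<lambda>x. ennreal (u x)) (cube a l)
         \<le> C * (measure lebesgue E / l ^ CARD('n)) powr (q / conj_exp p)"
    "\<And>a l E. 0 < l \<Longrightarrow> E \<in> sets lebesgue \<Longrightarrow> E \<subseteq> cube a l \<Longrightarrow> conj_exp p \<le> q \<Longrightarrow>
       0 < rmass (\<lambda>x. ennreal (v x)) (cube a l) \<Longrightarrow>
       measure lebesgue E / l ^ CARD('n)
         \<le> C * (rmass (\<lambda>x. ennreal (v x)) E / rmass (\<lambda>x. ennreal (v x)) (cube a l)) powr (conj_exp q / p)"
proof -
  have ul: "locally_integrable (\<lambda>x. ennreal (u x))" and vl: "locally_integrable (\<lambda>x. ennreal (v x))"
    using u v by (simp_all add: weight_def)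
  have pos: "0 < q / conj_exp p" "0 < conj_exp q / p"
    using conj_exp_gt1[OF p] conj_exp_gt1[OF q] p q by auto
  obtain C :: real where C: "\<And>Q E. Q \<in> cubes \<Longrightarrow> E \<in> sets lebesgue \<Longrightarrow> E \<subseteq> Q \<Longrightarrow>
        (conj_exp p \<ge> q \<longrightarrow>
           mass u E / mass u Q
             \<le> ennreal C * epowr (emeasure lebesgue E / emeasure lebesgue Q) (q / conj_exp p)) \<and>
        (conj_exp p \<le> q \<longrightarrow>
           emeasure lebesgue E / emeasure lebesgue Q
             \<le> ennreal C * epowr (mass v E / mass v Q) (conj_exp q / p))"
    using cc unfolding cube_condition_def by blast
  define C' where "C' = max C 1"
  have C': "0 < C'" "ennreal C \<le> ennreal C'"
    by (auto simp: C'_def intro!: ennreal_leI)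
  show thesis
  proof (rule that[OF C'(1)])
    fix a l E assume l: "0 < l" and E: "E \<in> sets lebesgue" "E \<subseteq> cube (a::real^'n) l"
    have bE: "bounded E"
      using E(2) bounded_subset cube_sets(2) by blast
    have em: "emeasure lebesgue E / emeasure lebesgue (cube a l) = ennreal (measure lebesgue E / l ^ CARD('n))"
      using l by (simp add: emeasure_cube emeasure_bounded_eq_measure[OF E(1) bE] divide_ennreal del: emeasure_completion)
    have um: "mass u E / mass u (cube a l) = ennreal (rmass (\<lambda>x. ennreal (u x)) E / rmass (\<lambda>x. ennreal (u x)) (cube a l))"
      if "0 < rmass (\<lambda>x. ennreal (u x)) (cube a l)"
      using that by (simp add: emass_eq_rmass[OF ul] bE divide_ennreal)
    have vm: "mass v E / mass v (cube a l) = ennreal (rmass (\<lambda>x. ennreal (v x)) E / rmass (\<lambda>x. ennreal (v x)) (cube a l))"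
      if "0 < rmass (\<lambda>x. ennreal (v x)) (cube a l)"
      using that by (simp add: emass_eq_rmass[OF vl] bE divide_ennreal)
    show "rmass (\<lambda>x. ennreal (u x)) E / rmass (\<lambda>x. ennreal (u x)) (cube a l)
         \<le> C' * (measure lebesgue E / l ^ CARD('n)) powr (q / conj_exp p)"
      if h: "q \<le> conj_exp p" "0 < rmass (\<lambda>x. ennreal (u x)) (cube a l)"
    proof -
      have "mass u E / mass u (cube a l) \<le> ennreal C * epowr (emeasure lebesgue E / emeasure lebesgue (cube a l)) (q / conj_exp p)"
        using C[OF cube_in_cubes[OF l] E] h by blast
      also have "\<dots> \<le> ennreal C' * epowr (emeasure lebesgue E / emeasure lebesgue (cube a l)) (q / conj_exp p)"
        by (intro mult_right_mono C') auto
      also have "\<dots> = ennreal (C' * (measure lebesgue E / l ^ CARD('n)) powr (q / conj_exp p))"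
        unfolding em using l pos C'(1) by (simp add: epowr_ennreal ennreal_mult)
      finally show ?thesis
        unfolding um[OF h(2)] using C'(1) by simp
    qed
    show "measure lebesgue E / l ^ CARD('n)
         \<le> C' * (rmass (\<lambda>x. ennreal (v x)) E / rmass (\<lambda>x. ennreal (v x)) (cube a l)) powr (conj_exp q / p)"
      if h: "conj_exp p \<le> q" "0 < rmass (\<lambda>x. ennreal (v x)) (cube a l)"
    proof -
      have "emeasure lebesgue E / emeasure lebesgue (cube a l) \<le> ennreal C * epowr (mass v E / mass v (cube a l)) (conj_exp q / p)"
        using C[OF cube_in_cubes[OF l] E] h by blast
      also have "\<dots> \<le> ennreal C' * epowr (mass v E / mass v (cube a l)) (conj_exp q / p)"
        by (intro mult_right_mono C') auto
      also have "\<dots> = ennreal (C' * (rmass (\<lambda>x. ennreal (v x)) E / rmass (\<lambda>x. ennreal (v x)) (cube a l)) powr (conj_exp q / p))"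
        unfolding vm[OF h(2)] using h pos C'(1) by (simp add: epowr_ennreal ennreal_mult)
      finally show ?thesis
        unfolding em using C'(1) by simp
    qed
  qed
qed

lemma bounded_set_condition_iff:
  fixes u v :: "real^'n \<Rightarrow> real"
  assumes p: "1 < p" and q: "1 < q" and u: "weight u" and v: "weight v"
  shows "bounded_set_condition p q u v \<longleftrightarrow>
    (\<exists>C>0. \<forall>E\<in>sets lebesgue. \<forall>F\<in>sets lebesgue. bounded E \<and> bounded F \<and> 0 < measure lebesgue F \<longrightarrow>
       rmass (\<lambda>x. ennreal (u x)) E powr (1 / q)
         \<le> C * measure lebesgue E powr (1 / max (conj_exp p) q)
             * measure lebesgue F powr (- (1 / conj_exp (max (conj_exp p) q)))
             * rmass (\<lambda>x. ennreal (v x)) F powr (1 / p))" (is "?L \<longleftrightarrow> (\<exists>C>0. ?R C)")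
proof -
  let ?s = "max (conj_exp p) q"
  have ul: "locally_integrable (\<lambda>x. ennreal (u x))" and vl: "locally_integrable (\<lambda>x. ennreal (v x))"
    using u v by (simp_all add: weight_def)
  have s: "0 < 1 / ?s" and pq: "0 < 1 / p" "0 < 1 / q"
    using p q by (auto simp: less_max_iff_disj)
  have eq: "(epowr (mass u E) (1 / q)
          \<le> ennreal C * epowr (emeasure lebesgue E) (1 / ?s)
              * epowr (emeasure lebesgue F) (- (1 / conj_exp ?s)) * epowr (mass v F) (1 / p)) \<longleftrightarrow>
      rmass (\<lambda>x. ennreal (u x)) E powr (1 / q)
         \<le> C * measure lebesgue E powr (1 / ?s)
             * measure lebesgue F powr (- (1 / conj_exp ?s))
             * rmass (\<lambda>x. ennreal (v x)) F powr (1 / p)"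
    if "0 < C" "E \<in> sets lebesgue" "F \<in> sets lebesgue" "bounded E" "bounded F" "0 < measure lebesgue F" for C E F
    using that
    by (simp add: emass_eq_rmass[OF ul] emass_eq_rmass[OF vl] emeasure_bounded_eq_measure
        epowr_ennreal[OF _ s] epowr_ennreal[OF _ pq(1)] epowr_ennreal[OF _ pq(2)] epowr_ennreal_pos
        ennreal_mult[symmetric] del: emeasure_completion)
  have pos: "0 < emeasure lebesgue F \<longleftrightarrow> 0 < measure lebesgue F" if "F \<in> sets lebesgue" "bounded F" for F :: "(real^'n) set"
    using that by (simp add: emeasure_bounded_eq_measure del: emeasure_completion)
  have L: "?L \<longleftrightarrow> (\<exists>C::real. \<forall>E\<in>sets lebesgue. \<forall>F\<in>sets lebesgue. bounded E \<and> bounded F \<and> 0 < measure lebesgue F \<longrightarrow>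
        epowr (mass u E) (1 / q)
          \<le> ennreal C * epowr (emeasure lebesgue E) (1 / ?s)
              * epowr (emeasure lebesgue F) (- (1 / conj_exp ?s)) * epowr (mass v F) (1 / p))"
    (is "_ \<longleftrightarrow> (\<exists>C. ?L' C)")
    unfolding bounded_set_condition_def Let_def using pos by metis
  \<comment> \<open>\<open>ennreal\<close> truncates a negative constant to 0, so enlarging C to a
    positive number only weakens the inequality, and real arithmetic becomes available.\<close>
  have mono: "?L' (max C 1)" if "?L' C" for C
  proof (intro ballI impI)
    fix E F :: "(real^'n) set" assume "E \<in> sets lebesgue" "F \<in> sets lebesgue" and "bounded E \<and> bounded F \<and> 0 < measure lebesgue F"
    with that have "epowr (mass u E) (1 / q)
          \<le> ennreal C * epowr (emeasure lebesgue E) (1 / ?s)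
              * epowr (emeasure lebesgue F) (- (1 / conj_exp ?s)) * epowr (mass v F) (1 / p)"
      by blast
    also have "\<dots> \<le> ennreal (max C 1) * epowr (emeasure lebesgue E) (1 / ?s)
              * epowr (emeasure lebesgue F) (- (1 / conj_exp ?s)) * epowr (mass v F) (1 / p)"
      by (intro mult_right_mono ennreal_leI) auto
    finally show "epowr (mass u E) (1 / q)
          \<le> ennreal (max C 1) * epowr (emeasure lebesgue E) (1 / ?s)
              * epowr (emeasure lebesgue F) (- (1 / conj_exp ?s)) * epowr (mass v F) (1 / p)" .
  qed
  have eq': "?L' C \<longleftrightarrow> ?R C" if "0 < C" for C
    using eq[OF that] by blast
  show ?thesis
  proof
    assume ?L
    then obtain C where "?L' C"
      using L by blast
    then have "?L' (max C 1)"
      by (rule mono)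
    then have "?R (max C 1)"
      by (subst (asm) eq') auto
    then show "\<exists>C>0. ?R C"
      by (intro exI[of _ "max C 1"]) auto
  next
    assume "\<exists>C>0. ?R C"
    then show ?L
      using L eq' by blast
  qed
qed

lemma le_powr_inverse:
  fixes x y a :: real
  assumes "0 \<le> x" "0 < a" "x powr (1 / a) \<le> y"
  shows "x \<le> y powr a"
proof -
  have "x = (x powr (1 / a)) powr a"
    using assms by (simp add: powr_powr)
  also have "\<dots> \<le> y powr a"
    using assms by (intro powr_mono2) auto
  finally show ?thesis .
qed

text \<open>Here s = p' and s' = p. The set E is placed in a huge cube, and the resulting density
  bound for w on small cubes reaches F through Hoelder's inequality.\<close>

lemma cube_condition_bound_if_ge:
  fixes u v :: "real^'n \<Rightarrow> real"
  assumes p: "1 < p" and q: "1 < q" and u: "weight u" and v: "weight v"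
    and w: "locally_integrable (dual_weight p v)" and N: "(u, v) \<in> N_Q p q"
    and cc: "cube_condition p q u v" and le: "q \<le> conj_exp p"
  shows "\<exists>C>0. \<forall>E\<in>sets lebesgue. \<forall>F\<in>sets lebesgue. bounded E \<and> bounded F \<and> 0 < measure lebesgue F \<longrightarrow>
       rmass (\<lambda>x. ennreal (u x)) E powr (1 / q)
         \<le> C * measure lebesgue E powr (1 / conj_exp p) * measure lebesgue F powr (- (1 / p))
             * rmass (\<lambda>x. ennreal (v x)) F powr (1 / p)"
proof -
  let ?U = "rmass (\<lambda>x. ennreal (u x))" and ?V = "rmass (\<lambda>x. ennreal (v x))" and ?W = "rmass (dual_weight p v)"
  let ?p' = "conj_exp p"
  have ul: "locally_integrable (\<lambda>x. ennreal (u x))"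
    using u by (simp add: weight_def)
  have p': "1 < ?p'"
    by (rule conj_exp_gt1[OF p])
  obtain C1 where C1: "0 < C1" "\<And>a l E. 0 < l \<Longrightarrow> E \<in> sets lebesgue \<Longrightarrow> E \<subseteq> cube a l \<Longrightarrow>
       0 < ?U (cube a l) \<Longrightarrow> ?U E / ?U (cube a l) \<le> C1 * (measure lebesgue E / l ^ CARD('n)) powr (q / ?p')"
    using cube_condition_real[OF p q u v cc] le by metis
  obtain C2 where C2: "0 < C2" "\<And>a b l r. 0 < l \<Longrightarrow> 0 < r \<Longrightarrow> l * r = 4 / CARD('n) \<Longrightarrow>
     ?U (cube a l) powr (1 / q) * ?W (cube b r) powr (1 / ?p') \<le> C2"
    using N_Q_cubes[OF p q u w N] by metis
  define \<kappa> where "\<kappa> = 4 / real CARD('n)"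
  have \<kappa>: "0 < \<kappa>"
    by (simp add: \<kappa>_def)
  define D where "D = C1 powr (1 / q) * C2"
  have D: "0 < D"
    using C1(1) C2(1) by (simp add: D_def)
  \<comment> \<open>The extra power of \<kappa> arises from l = \<kappa> / r, which turns l^-n into
    r^n / \<kappa>^n.\<close>
  define C where "C = D * (\<kappa> ^ CARD('n)) powr (- (1 / ?p'))"
  have C: "0 < C"
    using D \<kappa> by (simp add: C_def)
  have "?U E powr (1 / q) \<le> C * measure lebesgue E powr (1 / ?p') * measure lebesgue F powr (- (1 / p)) * ?V F powr (1 / p)"
    if E: "E \<in> sets lebesgue" "bounded E" and F: "F \<in> sets lebesgue" "bounded F" "0 < measure lebesgue F" for E F
  proof (cases "?U E = 0")
    case True
    then show ?thesis
      using C by simp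
  next
    case False
    then have uE: "0 < ?U E"
      using rmass_nonneg[of _ E] by (simp add: less_le)
    obtain L where L: "0 < L" "\<And>l. L \<le> l \<Longrightarrow> \<exists>a. E \<subseteq> cube a l"
      using bounded_subset_cube[OF E(2)] by metis
    \<comment> \<open>Chosen so that w(R)^(1/p') \<le> k |R|^(1/p') for small cubes R; forming it is
      the reason for treating u(E) = 0 separately.\<close>
    define k where "k = C * measure lebesgue E powr (1 / ?p') / ?U E powr (1 / q)"
    have k: "0 \<le> k"
      using C by (simp add: k_def)
    \<comment> \<open>Let R be the small cube and Q a cube of side \<kappa> / r containing E, which
      exists since r \<le> \<kappa> / L. The cube condition bounds u(E) through u(Q),
      \<open>N_Q\<close> cancels u(Q) against w(R), and 1 / |Q| is a fixed multiple of |R|.\<close>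
    have small: "?W (cube b r) \<le> k powr ?p' * measure lebesgue (cube b r)" if r: "0 < r" "r \<le> \<kappa> / L" for b r
    proof -
      define l where "l = \<kappa> / r"
      have l: "0 < l" "L \<le> l" "l * r = \<kappa>"
        using r \<kappa> L(1) by (auto simp: l_def field_simps)
      obtain a where a: "E \<subseteq> cube a l"
        using L(2) l(2) by blast
      have uQ: "0 < ?U (cube a l)"
        using uE rmass_mono[OF ul cube_sets(2) a] by linarith
      have "?U E \<le> C1 * (measure lebesgue E / l ^ CARD('n)) powr (q / ?p') * ?U (cube a l)"
        using C1(2)[OF l(1) E(1) a uQ] uQ by (simp add: pos_divide_le_eq)
      then have "?U E powr (1 / q) \<le> (C1 * (measure lebesgue E / l ^ CARD('n)) powr (q / ?p') * ?U (cube a l)) powr (1 / q)"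
        using uE q by (intro powr_mono2) auto
      also have "\<dots> = C1 powr (1 / q) * (measure lebesgue E / l ^ CARD('n)) powr (1 / ?p') * ?U (cube a l) powr (1 / q)"
        using C1(1) l(1) uQ q by (simp add: powr_mult powr_powr)
      finally have "?U E powr (1 / q) * ?W (cube b r) powr (1 / ?p') \<le>
          C1 powr (1 / q) * (measure lebesgue E / l ^ CARD('n)) powr (1 / ?p') * (?U (cube a l) powr (1 / q) * ?W (cube b r) powr (1 / ?p'))"
        by (simp only: mult.assoc[symmetric] mult_right_mono powr_ge_zero)
      also have "\<dots> \<le> C1 powr (1 / q) * (measure lebesgue E / l ^ CARD('n)) powr (1 / ?p') * C2"
        using l C1(1) r(1) by (intro mult_left_mono C2(2)) (auto simp: \<kappa>_def)
      also have "\<dots> = D * (measure lebesgue E / l ^ CARD('n)) powr (1 / ?p')"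
        by (simp add: D_def)
      also have "measure lebesgue E / l ^ CARD('n) = measure lebesgue E * (r ^ CARD('n) / \<kappa> ^ CARD('n))"
        using r(1) \<kappa> by (simp add: l_def power_divide)
      also have "D * (measure lebesgue E * (r ^ CARD('n) / \<kappa> ^ CARD('n))) powr (1 / ?p')
          = C * measure lebesgue E powr (1 / ?p') * (r ^ CARD('n)) powr (1 / ?p')"
        using r(1) \<kappa> by (simp add: C_def powr_mult powr_divide powr_minus field_simps)
      finally have "?W (cube b r) powr (1 / ?p') \<le> k * (r ^ CARD('n)) powr (1 / ?p')"
        using uE by (simp add: k_def field_simps)
      then have "?W (cube b r) \<le> (k * (r ^ CARD('n)) powr (1 / ?p')) powr ?p'"
        using p' by (intro le_powr_inverse) auto
      also have "\<dots> = k powr ?p' * r ^ CARD('n)"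
        using k r(1) p' by (simp add: powr_mult powr_powr)
      finally show ?thesis
        using r(1) by (simp add: measure_cube)
    qed
    have WF: "?W F \<le> k powr ?p' * measure lebesgue F"
      by (rule rmass_le_of_small_cubes[OF w _ _ small F(1,2)]) (use \<kappa> L(1) in auto)
    \<comment> \<open>Hoelder combined with w(F) \<le> k^p' |F|; dividing by |F|^(1/p') leaves
      |F|^(1/p) on the left.\<close>
    have "measure lebesgue F \<le> ?V F powr (1 / p) * ?W F powr (1 / ?p')"
      by (rule measure_le_weights[OF p v w F(1,2)])
    also have "\<dots> \<le> ?V F powr (1 / p) * (k powr ?p' * measure lebesgue F) powr (1 / ?p')"
      using WF p' by (intro mult_left_mono powr_mono2) auto
    also have "\<dots> = ?V F powr (1 / p) * (k * measure lebesgue F powr (1 / ?p'))"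
      using k p' by (simp add: powr_mult powr_powr)
    finally have "measure lebesgue F * measure lebesgue F powr (- (1 / ?p')) \<le> (?V F powr (1 / p) * (k * measure lebesgue F powr (1 / ?p'))) * measure lebesgue F powr (- (1 / ?p'))"
      by (rule mult_right_mono) simp
    also have "\<dots> = ?V F powr (1 / p) * k"
      using F(3) by (simp add: powr_minus)
    also have "measure lebesgue F * measure lebesgue F powr (- (1 / ?p')) = measure lebesgue F powr (1 / p)"
      using F(3) powr_add[of "measure lebesgue F" 1 "- (1 / ?p')"] by (simp add: conj_exp_inverse[OF p])
    finally have "?U E powr (1 / q) * measure lebesgue F powr (1 / p) \<le> C * measure lebesgue E powr (1 / ?p') * ?V F powr (1 / p)"
      using uE by (simp add: k_def field_simps)
    then show ?thesis
      using F(3) by (simp add: powr_minus field_simps)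
  qed
  then show ?thesis
    using C by blast
qed

text \<open>Here s = q. The huge cube now surrounds F, and the density bound on small cubes is for
  u, hence applies to E directly.\<close>

lemma cube_condition_bound_if_le:
  fixes u v :: "real^'n \<Rightarrow> real"
  assumes p: "1 < p" and q: "1 < q" and u: "weight u" and v: "weight v"
    and w: "locally_integrable (dual_weight p v)" and N: "(u, v) \<in> N_Q p q"
    and cc: "cube_condition p q u v" and le: "conj_exp p \<le> q"
  shows "\<exists>C>0. \<forall>E\<in>sets lebesgue. \<forall>F\<in>sets lebesgue. bounded E \<and> bounded F \<and> 0 < measure lebesgue F \<longrightarrow>
       rmass (\<lambda>x. ennreal (u x)) E powr (1 / q)
         \<le> C * measure lebesgue E powr (1 / q) * measure lebesgue F powr (- (1 / conj_exp q))
             * rmass (\<lambda>x. ennreal (v x)) F powr (1 / p)"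
proof -
  let ?U = "rmass (\<lambda>x. ennreal (u x))" and ?V = "rmass (\<lambda>x. ennreal (v x))" and ?W = "rmass (dual_weight p v)"
  let ?p' = "conj_exp p" and ?q' = "conj_exp q"
  have ul: "locally_integrable (\<lambda>x. ennreal (u x))"
    using u by (simp add: weight_def)
  have p': "1 < ?p'" and q': "1 < ?q'"
    by (rule conj_exp_gt1, fact)+
  obtain C1 where C1: "0 < C1" "\<And>a l E. 0 < l \<Longrightarrow> E \<in> sets lebesgue \<Longrightarrow> E \<subseteq> cube a l \<Longrightarrow>
       0 < ?V (cube a l) \<Longrightarrow> measure lebesgue E / l ^ CARD('n) \<le> C1 * (?V E / ?V (cube a l)) powr (?q' / p)"
    using cube_condition_real[OF p q u v cc] le by metis
  obtain C2 where C2: "0 < C2" "\<And>a b l r. 0 < l \<Longrightarrow> 0 < r \<Longrightarrow> l * r = 4 / CARD('n) \<Longrightarrow>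
     ?U (cube a l) powr (1 / q) * ?W (cube b r) powr (1 / ?p') \<le> C2"
    using N_Q_cubes[OF p q u w N] by metis
  define \<kappa> where "\<kappa> = 4 / real CARD('n)"
  have \<kappa>: "0 < \<kappa>"
    by (simp add: \<kappa>_def)
  define D where "D = C1 powr (1 / ?q') * C2"
  have D: "0 < D"
    using C1(1) C2(1) by (simp add: D_def)
  define C where "C = D * (\<kappa> ^ CARD('n)) powr (- (1 / q))"
  have C: "0 < C"
    using D \<kappa> by (simp add: C_def)
  have "?U E powr (1 / q) \<le> C * measure lebesgue E powr (1 / q) * measure lebesgue F powr (- (1 / ?q')) * ?V F powr (1 / p)"
    if E: "E \<in> sets lebesgue" "bounded E" and F: "F \<in> sets lebesgue" "bounded F" "0 < measure lebesgue F" for E F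
  proof -
    obtain L where L: "0 < L" "\<And>l. L \<le> l \<Longrightarrow> \<exists>a. F \<subseteq> cube a l"
      using bounded_subset_cube[OF F(2)] by metis
    define k where "k = C * measure lebesgue F powr (- (1 / ?q')) * ?V F powr (1 / p)"
    have k: "0 \<le> k"
      using C by (simp add: k_def)
    have small: "?U (cube b r) \<le> k powr q * measure lebesgue (cube b r)" if r: "0 < r" "r \<le> \<kappa> / L" for b r
    proof -
      define l where "l = \<kappa> / r"
      have l: "0 < l" "L \<le> l" "l * r = \<kappa>"
        using r \<kappa> L(1) by (auto simp: l_def field_simps)
      obtain a where a: "F \<subseteq> cube a l"
        using L(2) l(2) by blast
      define M where "M = l ^ CARD('n)"
      have M: "0 < M"
        using l(1) by (simp add: M_def)
      \<comment> \<open>The cube condition involves v(Q) and \<open>N_Q\<close> involves w(Q) for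
        the large cube Q; Hoelder on Q links the two. It also forces v(Q) > 0, since |Q| >
        0.\<close>
      have MVW: "M \<le> ?V (cube a l) powr (1 / p) * ?W (cube a l) powr (1 / ?p')"
        using measure_le_weights[OF p v w cube_sets(1,2), of a l] l(1) by (simp add: measure_cube M_def)
      have vQ: "0 < ?V (cube a l)"
      proof (rule ccontr)
        assume "\<not> 0 < ?V (cube a l)"
        then have "?V (cube a l) = 0"
          using rmass_nonneg[of "\<lambda>x. ennreal (v x)" "cube a l"] by linarith
        with MVW M p show False
          by simp
      qed
      have "(measure lebesgue F / M) powr (1 / ?q') \<le> (C1 * (?V F / ?V (cube a l)) powr (?q' / p)) powr (1 / ?q')"
        using C1(2)[OF l(1) F(1) a vQ] M q' unfolding M_def by (intro powr_mono2) auto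
      also have "\<dots> = C1 powr (1 / ?q') * ?V F powr (1 / p) / ?V (cube a l) powr (1 / p)"
        using C1(1) vQ q' by (simp add: powr_mult powr_powr powr_divide)
      finally have 1: "?V (cube a l) powr (1 / p) * (measure lebesgue F / M) powr (1 / ?q') \<le> C1 powr (1 / ?q') * ?V F powr (1 / p)"
        using vQ by (simp add: field_simps)
      have "(?U (cube b r) powr (1 / q) * M) * (measure lebesgue F / M) powr (1 / ?q')
          \<le> (?U (cube b r) powr (1 / q) * (?V (cube a l) powr (1 / p) * ?W (cube a l) powr (1 / ?p'))) * (measure lebesgue F / M) powr (1 / ?q')"
        by (intro mult_right_mono mult_left_mono MVW) auto
      also have "\<dots> = (?U (cube b r) powr (1 / q) * ?W (cube a l) powr (1 / ?p')) * (?V (cube a l) powr (1 / p) * (measure lebesgue F / M) powr (1 / ?q'))"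
        by (simp only: mult_ac)
      \<comment> \<open>The roles of the cubes in \<open>C2\<close> are exchanged: u is taken on the
        small cube and w on the large one.\<close>
      also have "\<dots> \<le> C2 * (C1 powr (1 / ?q') * ?V F powr (1 / p))"
        using l C2(1) r(1) by (intro mult_mono C2(2) 1) (auto simp: \<kappa>_def mult.commute)
      also have "\<dots> = D * ?V F powr (1 / p)"
        by (simp add: D_def)
      also have "(?U (cube b r) powr (1 / q) * M) * (measure lebesgue F / M) powr (1 / ?q')
          = (?U (cube b r) powr (1 / q) * M powr (1 / q)) * measure lebesgue F powr (1 / ?q')"
      proof -
        \<comment> \<open>Dividing |Q| by |Q|^(1/q') leaves |Q|^(1/q), which converts into
          |R|^(-1/q) for the small cube R.\<close>
        have "M = M powr (1 / q) * M powr (1 / ?q')"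
          using M powr_add[of M "1 / q" "1 / ?q'"] by (simp add: conj_exp_inverse[OF q])
        then have "M / M powr (1 / ?q') = M powr (1 / q)"
          using M by (metis nonzero_mult_div_cancel_right powr_gt_zero less_irrefl)
        then show ?thesis
          using M by (simp add: powr_divide field_simps)
      qed
      also have "M = \<kappa> ^ CARD('n) / r ^ CARD('n)"
        by (simp add: M_def l_def power_divide)
      finally have "?U (cube b r) powr (1 / q) \<le> k * (r ^ CARD('n)) powr (1 / q)"
        using r(1) \<kappa> F(3) by (simp add: k_def C_def powr_divide powr_minus field_simps)
      then have "?U (cube b r) \<le> (k * (r ^ CARD('n)) powr (1 / q)) powr q"
        using q by (intro le_powr_inverse) auto
      also have "\<dots> = k powr q * r ^ CARD('n)"
        using k r(1) q by (simp add: powr_mult powr_powr)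
      finally show ?thesis
        using r(1) by (simp add: measure_cube)
    qed
    have "?U E \<le> k powr q * measure lebesgue E"
      by (rule rmass_le_of_small_cubes[OF ul _ _ small E]) (use \<kappa> L(1) in auto)
    then have "?U E powr (1 / q) \<le> (k powr q * measure lebesgue E) powr (1 / q)"
      using q by (intro powr_mono2) auto
    also have "\<dots> = k * measure lebesgue E powr (1 / q)"
      using k q by (simp add: powr_mult powr_powr)
    finally show ?thesis
      by (simp add: k_def mult_ac)
  qed
  then show ?thesis
    using C by blast
qed

lemma cube_condition_imp_bounded_set_condition:
  fixes u v :: "real^'n \<Rightarrow> real"
  assumes p: "1 < p" and q: "1 < q" and u: "weight u" and v: "weight v"
    and w: "locally_integrable (dual_weight p v)" and N: "(u, v) \<in> N_Q p q"
    and cc: "cube_condition p q u v"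
  shows "bounded_set_condition p q u v"
proof (cases "q \<le> conj_exp p")
  case True
  then show ?thesis
    using cube_condition_bound_if_ge[OF assms True]
    by (simp add: bounded_set_condition_iff[OF p q u v] max_absorb1 conj_exp_conj_exp[OF p])
next
  case False
  then have "conj_exp p \<le> q"
    by simp
  from cube_condition_bound_if_le[OF assms this] this show ?thesis
    by (simp add: bounded_set_condition_iff[OF p q u v] max_absorb2)
qed

section \<open>Weak-type estimates\<close>

text \<open>With F = A, the factor |A|^(-1/s') of the bounded set condition cancels the
  |A|^((s-1)/s) from the level set estimate, leaving v(A)^(1/p) / \<alpha>.\<close>

lemma bounded_set_condition_weak_type:
  fixes u v :: "real^'n \<Rightarrow> real"
  assumes p: "1 < p" and q: "1 < q" and u: "weight u" and v: "weight v"
    and bsc: "bounded_set_condition p q u v" and s: "2 \<le> max (conj_exp p) q"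
  obtains C where "0 < C"
    "\<And>A \<alpha>. A \<in> sets lebesgue \<Longrightarrow> bounded A \<Longrightarrow> 0 < \<alpha> \<Longrightarrow>
       mass u {z. \<alpha> < cmod (fourier (indicator A) z)}
         \<le> ennreal ((C * rmass (\<lambda>x. ennreal (v x)) A powr (1 / p) / \<alpha>) powr q)"
proof -
  let ?U = "rmass (\<lambda>x. ennreal (u x))" and ?V = "rmass (\<lambda>x. ennreal (v x))"
  define s where "s = max (conj_exp p) q"
  have s2: "2 \<le> s"
    using assms by (simp add: s_def)
  have ul: "locally_integrable (\<lambda>x. ennreal (u x))"
    using u by (simp add: weight_def)
  obtain C0 where C0: "0 < C0" "\<And>E F. E \<in> sets lebesgue \<Longrightarrow> F \<in> sets lebesgue \<Longrightarrow> bounded E \<Longrightarrow> bounded F \<Longrightarrow> 0 < measure lebesgue F \<Longrightarrow>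
       ?U E powr (1 / q) \<le> C0 * measure lebesgue E powr (1 / s) * measure lebesgue F powr (- (1 / conj_exp s)) * ?V F powr (1 / p)"
    using bsc unfolding bounded_set_condition_iff[OF p q u v] s_def[symmetric] by blast
  define c where "c = exp (1 / 2) * (2 * pi) ^ CARD('n)"
  have c: "0 < c"
    by (simp add: c_def)
  define C where "C = C0 * c powr (1 / s)"
  have "mass u {z. \<alpha> < cmod (fourier (indicator A) z)} \<le> ennreal ((C * ?V A powr (1 / p) / \<alpha>) powr q)"
    if A: "A \<in> sets lebesgue" "bounded A" and \<alpha>: "0 < \<alpha>" for A \<alpha>
  proof -
    have Al: "A \<in> lmeasurable"
      using A by (simp add: bounded_set_imp_lmeasurable)
    let ?E = "{z. \<alpha> < cmod (fourier (indicator A) z)}"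
    \<comment> \<open>The level set may be unbounded, so it is cut to balls; the bound is uniform in
      k and passes to the increasing union.\<close>
    define E where "E k = ?E \<inter> cball 0 (real k)" for k
    have [measurable]: "fourier (indicator A) \<in> borel_measurable lebesgue"
      by (rule measurable_completion) (simp add: fourier_indicator_measurable[OF Al])
    have "?E \<inter> space lebesgue \<in> sets lebesgue"
      by measurable
    then have Em: "?E \<in> sets lebesgue"
      by simp
    have Ek: "E k \<in> sets lebesgue" "bounded (E k)" for k
      unfolding E_def using Em by (auto intro: bounded_subset[OF bounded_cball])
    have bound: "?U (E k) powr (1 / q) \<le> C * ?V A powr (1 / p) / \<alpha>" for k
    proof (cases "measure lebesgue A = 0")
      \<comment> \<open>The bounded set condition requires |F| > 0. If A is null, its transform
        vanishes identically and the level set is empty.\<close>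
      case True
      then have "fourier (indicator A) z = 0" for z
        using norm_fourier_indicator_le[OF Al, of z] by simp
      then have "E k = {}"
        using \<alpha> by (simp add: E_def)
      then have "?U (E k) = 0"
        by (simp add: rmass_def emass_def)
      then show ?thesis
        using C0(1) \<alpha> by (simp add: C_def)
    next
      case False
      then have mA: "0 < measure lebesgue A"
        by (simp add: less_le)
      have "\<alpha> powr s * measure lebesgue (E k) \<le> c * measure lebesgue A powr (s - 1)"
        unfolding c_def using Ek Al \<alpha> s2 by (intro fourier_indicator_level) (auto simp: E_def)
      then have "measure lebesgue (E k) \<le> c * measure lebesgue A powr (s - 1) / \<alpha> powr s"
        using \<alpha> by (simp add: field_simps)
      then have "measure lebesgue (E k) powr (1 / s) \<le> (c * measure lebesgue A powr (s - 1) / \<alpha> powr s) powr (1 / s)"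
        using s2 by (intro powr_mono2) auto
      also have "\<dots> = c powr (1 / s) * measure lebesgue A powr ((s - 1) / s) / \<alpha>"
        using s2 \<alpha> c by (simp add: powr_mult powr_divide powr_powr)
      also have "(s - 1) / s = 1 / conj_exp s"
        using s2 by (simp add: conj_exp_def)
      finally have Es: "measure lebesgue (E k) powr (1 / s) \<le> c powr (1 / s) * measure lebesgue A powr (1 / conj_exp s) / \<alpha>" .
      have "?U (E k) powr (1 / q) \<le> C0 * measure lebesgue (E k) powr (1 / s) * measure lebesgue A powr (- (1 / conj_exp s)) * ?V A powr (1 / p)"
        by (rule C0(2)[OF Ek(1) A(1) Ek(2) A(2) mA])
      also have "\<dots> \<le> C0 * (c powr (1 / s) * measure lebesgue A powr (1 / conj_exp s) / \<alpha>) * measure lebesgue A powr (- (1 / conj_exp s)) * ?V A powr (1 / p)"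
        using C0(1) by (intro mult_right_mono mult_left_mono Es) auto
      also have "\<dots> = C * ?V A powr (1 / p) / \<alpha>"
        using mA by (simp add: C_def powr_minus)
      finally show ?thesis .
    qed
    have "?U (E k) \<le> (C * ?V A powr (1 / p) / \<alpha>) powr q" for k
      using bound q by (intro le_powr_inverse) auto
    then have le: "mass u (E k) \<le> ennreal ((C * ?V A powr (1 / p) / \<alpha>) powr q)" for k
      by (simp add: emass_eq_rmass[OF ul] Ek ennreal_leI)
    have "?E = (\<Union>k. E k)"
      using real_arch_simple by (auto simp: E_def)
    moreover have "mass u (\<Union>k. E k) = (SUP k. mass u (E k))"
    proof -
      have "incseq E"
        by (auto simp: incseq_def E_def)
      then have "(SUP k. emeasure (density lebesgue u) (E k)) = emeasure (density lebesgue u) (\<Union>k. E k)"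
        using Ek(1) by (intro SUP_emeasure_incseq) auto
      moreover have "(\<Union>k. E k) \<in> sets lebesgue"
        using Ek(1) by auto
      ultimately show ?thesis
        using emass_eq_emeasure[OF locally_integrable_measurable[OF ul]] Ek(1) by simp
    qed
    ultimately show ?thesis
      using le by (simp add: SUP_le_iff)
  qed
  then show thesis
    using C0(1) c by (intro that[of C]) (auto simp: C_def)
qed

text \<open>Fatou's lemma for indicators: a strict inequality for the limit holds eventually along
  the sequence.\<close>

lemma emeasure_superlevel_limit_le:
  fixes h :: "nat \<Rightarrow> 'a \<Rightarrow> 'b::{real_normed_vector, second_countable_topology}"
  assumes [measurable]: "\<And>i. h i \<in> borel_measurable M" "g \<in> borel_measurable M"
    and lim: "AE x in M. (\<lambda>i. h i x) \<longlonglongrightarrow> g x"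
    and le: "\<And>i. emeasure M {x \<in> space M. \<alpha> < norm (h i x)} \<le> c"
  shows "emeasure M {x \<in> space M. \<alpha> < norm (g x)} \<le> c"
proof -
  have "emeasure M {x \<in> space M. \<alpha> < norm (g x)} = (\<integral>\<^sup>+x. indicator {x \<in> space M. \<alpha> < norm (g x)} x \<partial>M)"
    by simp
  also have "\<dots> \<le> (\<integral>\<^sup>+x. liminf (\<lambda>i. indicator {x \<in> space M. \<alpha> < norm (h i x)} x) \<partial>M)"
  proof (rule nn_integral_mono_AE)
    show "AE x in M. indicator {x \<in> space M. \<alpha> < norm (g x)} x
        \<le> (liminf (\<lambda>i. indicator {x \<in> space M. \<alpha> < norm (h i x)} x) :: ennreal)"
      using lim AE_space
    proof eventually_elim
      case (elim x)
      show ?case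
      proof (cases "\<alpha> < norm (g x)")
        case True
        then have "\<forall>\<^sub>F i in sequentially. \<alpha> < norm (h i x)"
          using tendsto_norm[OF elim(1)] by (simp add: order_tendsto_iff)
        then have "(1 :: ennreal) \<le> liminf (\<lambda>i. indicator {x \<in> space M. \<alpha> < norm (h i x)} x)"
          using elim(2) by (intro Liminf_bounded) (auto elim!: eventually_mono simp: indicator_def)
        then show ?thesis
          using True elim(2) by (simp add: indicator_def)
      qed (simp add: indicator_def)
    qed
  qed
  also have "\<dots> \<le> liminf (\<lambda>i. \<integral>\<^sup>+x. indicator {x \<in> space M. \<alpha> < norm (h i x)} x \<partial>M)"
    by (rule nn_integral_liminf) measurable
  also have "\<dots> \<le> liminf (\<lambda>i::nat. c)"
    using le by (intro Liminf_mono always_eventually) simp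
  also have "\<dots> = c"
    by (simp add: Liminf_const)
  finally show ?thesis .
qed

section \<open>Superlevel sets and the weak quasinorm\<close>

lemma mass_superlevel:
  assumes "weight u" "g \<in> borel_measurable lebesgue"
  shows "mass u {z. \<alpha> < cmod (g z)} = emeasure (density lebesgue u) {z. \<alpha> < cmod (g z)}"
    and "{z. \<alpha> < cmod (g z)} \<in> sets lebesgue"
proof -
  note [measurable] = assms(2)
  have "{z. \<alpha> < cmod (g z)} \<inter> space lebesgue \<in> sets lebesgue"
    by measurable
  then show 1: "{z. \<alpha> < cmod (g z)} \<in> sets lebesgue"
    by simp
  show "mass u {z. \<alpha> < cmod (g z)} = emeasure (density lebesgue u) {z. \<alpha> < cmod (g z)}"
    using assms(1) by (intro emass_eq_emeasure 1) (simp add: weight_def locally_integrable_def)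
qed

lemma weak_norm_le:
  assumes q: "0 < q" and K: "0 \<le> K"
    and le: "\<And>\<alpha>. 0 < \<alpha> \<Longrightarrow> mass u {z. \<alpha> < cmod (h z)} \<le> ennreal ((K / \<alpha>) powr q)"
  shows "weak_norm q u h \<le> ennreal K"
  unfolding weak_norm_def
proof (rule SUP_least)
  fix \<alpha> :: real assume "\<alpha> \<in> {0<..}"
  then have \<alpha>: "0 < \<alpha>"
    by simp
  have "epowr (mass u {z. \<alpha> < cmod (h z)}) (1 / q) \<le> epowr (ennreal ((K / \<alpha>) powr q)) (1 / q)"
    using q le[OF \<alpha>] by (intro epowr_mono) auto
  also have "\<dots> = ennreal (K / \<alpha>)"
    using q K \<alpha> by (simp add: epowr_ennreal powr_powr)
  finally have "ennreal \<alpha> * epowr (mass u {z. \<alpha> < cmod (h z)}) (1 / q) \<le> ennreal \<alpha> * ennreal (K / \<alpha>)"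
    by (rule mult_left_mono) simp
  also have "\<dots> = ennreal K"
    using \<alpha> K by (simp add: ennreal_mult[symmetric])
  finally show "ennreal \<alpha> * epowr (mass u {z. \<alpha> < cmod (h z)}) (1 / q) \<le> ennreal K" .
qed

lemma mass_superlevel_le_weak_norm:
  assumes q: "0 < q" and \<alpha>: "0 < \<alpha>" and fin: "weak_norm q u h < \<infinity>"
  shows "mass u {z. \<alpha> < cmod (h z)} \<le> ennreal ((enn2real (weak_norm q u h) / \<alpha>) powr q)"
proof -
  define X where "X = mass u {z. \<alpha> < cmod (h z)}"
  have le: "ennreal \<alpha> * epowr X (1 / q) \<le> weak_norm q u h"
    unfolding weak_norm_def X_def using \<alpha> by (intro SUP_upper) auto
  define K where "K = enn2real (weak_norm q u h)"
  have wK: "weak_norm q u h = ennreal K"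
    using fin by (simp add: K_def)
  have "X \<noteq> \<infinity>"
  proof
    assume "X = \<infinity>"
    then have "ennreal \<alpha> * epowr X (1 / q) = \<infinity>"
      using q \<alpha> by (simp add: epowr_def ennreal_mult_top)
    with le fin show False
      by simp
  qed
  then obtain x where x: "0 \<le> x" "X = ennreal x"
    by (cases X) auto
  have "ennreal (\<alpha> * x powr (1 / q)) \<le> ennreal K"
    using le q \<alpha> x by (simp add: wK epowr_ennreal ennreal_mult)
  then have "\<alpha> * x powr (1 / q) \<le> K"
    by (simp add: K_def)
  then have "x powr (1 / q) \<le> K / \<alpha>"
    using \<alpha> by (simp add: field_simps)
  then have "x \<le> (K / \<alpha>) powr q"
    using q x by (intro le_powr_inverse) auto
  then show ?thesis
    unfolding X_def[symmetric] K_def[symmetric] x(2) by (rule ennreal_leI)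
qed

text \<open>Convergence in the quasinorm implies convergence in u-measure, the form in which the
  defining limit of the extension is exploited later.\<close>

lemma mass_superlevel_tendsto_0:
  assumes q: "0 < q" and \<alpha>: "0 < \<alpha>" and lim: "(\<lambda>k. weak_norm q u (h k)) \<longlonglongrightarrow> 0"
  shows "(\<lambda>k. mass u {z. \<alpha> < cmod (h k z)}) \<longlonglongrightarrow> 0"
proof (rule tendsto_sandwich[OF _ _ tendsto_const])
  \<comment> \<open>The quasinorms are finite only eventually, and only then does the real-valued
    bound apply.\<close>
  show "\<forall>\<^sub>F k in sequentially. mass u {z. \<alpha> < cmod (h k z)} \<le> ennreal ((enn2real (weak_norm q u (h k)) / \<alpha>) powr q)"
    using order_tendstoD(2)[OF lim, of \<infinity>]
    by (auto elim!: eventually_mono intro: mass_superlevel_le_weak_norm[OF q \<alpha>])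
  have "(\<lambda>k. enn2real (weak_norm q u (h k))) \<longlonglongrightarrow> enn2real 0"
    using lim by (intro tendsto_enn2real) auto
  then have "(\<lambda>k. (enn2real (weak_norm q u (h k)) / \<alpha>) powr q) \<longlonglongrightarrow> (0 / \<alpha>) powr q"
    using q \<alpha> by (intro tendsto_powr' tendsto_divide tendsto_const) auto
  then show "(\<lambda>k. ennreal ((enn2real (weak_norm q u (h k)) / \<alpha>) powr q)) \<longlonglongrightarrow> 0"
    using tendsto_ennrealI by fastforce
qed simp

section \<open>Extension of the Fourier transform\<close>

text \<open>Continuity from above of the measure with density v, made available by v(A) being
  finite.\<close>

lemma rmass_diff_tendsto_0:
  fixes v :: "real^'n \<Rightarrow> real"
  assumes v: "weight v" and A: "A \<in> sets lebesgue" and fin: "mass v A < \<infinity>" and S: "exhausts S A"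
  shows "(\<lambda>j. rmass (\<lambda>x. ennreal (v x)) (A - S j)) \<longlonglongrightarrow> 0"
proof -
  have Sm: "S j \<in> sets lebesgue" for j
    using S by (simp add: exhausts_def)
  let ?M = "density lebesgue (\<lambda>x. ennreal (v x))"
  have em: "mass v B = emeasure ?M B" if "B \<in> sets lebesgue" for B
    using v that by (intro emass_eq_emeasure) (auto simp: weight_def locally_integrable_def)
  have "(\<lambda>j. emeasure ?M (A - S j)) \<longlonglongrightarrow> emeasure ?M (\<Inter>j. A - S j)"
  proof (rule Lim_emeasure_decseq)
    show "decseq (\<lambda>j. A - S j)"
      using S by (auto simp: exhausts_def decseq_def incseq_def)
    show "emeasure ?M (A - S j) \<noteq> \<infinity>" for j
      using emass_mono[of "A - S j" A "\<lambda>x. ennreal (v x)"] fin em[of "A - S j"] A Sm by (auto simp: top_unique)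
  qed (use A Sm in auto)
  moreover have "(\<Inter>j. A - S j) = {}"
    using S by (auto simp: exhausts_def)
  ultimately have "(\<lambda>j. emeasure ?M (A - S j)) \<longlonglongrightarrow> 0"
    by (metis emeasure_empty)
  then have "(\<lambda>j. mass v (A - S j)) \<longlonglongrightarrow> 0"
    using A Sm by (simp add: em sets.Diff)
  then have "(\<lambda>j. enn2real (mass v (A - S j))) \<longlonglongrightarrow> enn2real 0"
    by (intro tendsto_enn2real) auto
  then show ?thesis
    by (simp add: rmass_def)
qed

lemma rmass_mono_fin:
  assumes "A \<subseteq> B" "emass f B < \<infinity>"
  shows "rmass f A \<le> rmass f B"
  unfolding rmass_def using assms emass_mono[OF assms(1), of f] by (intro enn2real_mono) auto

lemma exhausts_cball:
  fixes A :: "(real^'n) set"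
  assumes "A \<in> sets lebesgue"
  shows "exhausts (\<lambda>k. A \<inter> cball 0 (real k)) A"
  using assms real_arch_simple
  by (auto simp: exhausts_def incseq_def intro: bounded_subset[OF bounded_cball])

text \<open>By Borel-Cantelli almost every point lies in only finitely many exceptional sets, so its
  increments are dominated by a geometric series and telescope.\<close>

lemma AE_convergent_of_fast_Cauchy:
  fixes f :: "nat \<Rightarrow> 'a \<Rightarrow> complex"
  assumes [measurable]: "\<And>i. f i \<in> borel_measurable M"
    and le: "\<And>i. emeasure M {x \<in> space M. (1 / 2) ^ i < cmod (f (Suc i) x - f i x)} \<le> ennreal ((1 / 2) ^ i)"
  shows "AE x in M. convergent (\<lambda>i. f i x)"
proof -
  let ?A = "\<lambda>i. {x \<in> space M. (1 / 2) ^ i < cmod (f (Suc i) x - f i x)}"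
  have "AE x in M. \<forall>\<^sub>F i in sequentially. x \<in> space M - ?A i"
  proof (rule borel_cantelli_AE1)
    show "?A i \<in> sets M" for i
      by measurable
    show "emeasure M (?A i) < \<infinity>" for i
      using le[of i] by (simp add: le_less_trans)
    show "summable (\<lambda>i. measure M (?A i))"
    proof (rule summable_comparison_test'[OF summable_geometric[of "1 / 2 :: real"], of 0])
      show "norm (measure M (?A i)) \<le> (1 / 2) ^ i" for i
        using le[of i] by (simp add: measure_def enn2real_leI)
    qed simp
  qed
  then show ?thesis
  proof eventually_elim
    case (elim x)
    have "summable (\<lambda>i. f (Suc i) x - f i x)"
    proof (rule summable_comparison_test_ev)
      show "\<forall>\<^sub>F i in sequentially. norm (f (Suc i) x - f i x) \<le> (1 / 2) ^ i"
        using elim by eventually_elim auto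
    qed (simp add: summable_geometric)
    then have "convergent (\<lambda>n. \<Sum>i<n. f (Suc i) x - f i x)"
      by (simp add: summable_iff_convergent)
    then have "convergent (\<lambda>n. f n x - f 0 x)"
      using sum_lessThan_telescope[of "\<lambda>i. f i x"] by simp
    then have "convergent (\<lambda>n. (f n x - f 0 x) + f 0 x)"
      by (intro convergent_add convergent_const)
    then show ?case
      by simp
  qed
qed

text \<open>Applied to differences of sets, the weak-type bound makes the truncated transforms
  Cauchy in u-measure. The bound for the limit is stated for arbitrary bounded B inside A, so that
  one g serves every exhaustion.\<close>

lemma fourier_indicator_limit:
  fixes u v :: "real^'n \<Rightarrow> real"
  assumes p: "1 < p" and q: "1 < q" and u: "weight u" and v: "weight v" and C: "0 < C"
    and weak: "\<And>A \<alpha>. A \<in> sets lebesgue \<Longrightarrow> bounded A \<Longrightarrow> 0 < \<alpha> \<Longrightarrow>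
       mass u {z. \<alpha> < cmod (fourier (indicator A) z)}
         \<le> ennreal ((C * rmass (\<lambda>x. ennreal (v x)) A powr (1 / p) / \<alpha>) powr q)"
    and A: "A \<in> sets lebesgue" and fin: "mass v A < \<infinity>"
  obtains g where "g \<in> borel_measurable lebesgue"
    "\<And>B \<alpha>. B \<in> sets lebesgue \<Longrightarrow> bounded B \<Longrightarrow> B \<subseteq> A \<Longrightarrow> 0 < \<alpha> \<Longrightarrow>
       mass u {z. \<alpha> < cmod (fourier (indicator B) z - g z)}
         \<le> ennreal ((C * rmass (\<lambda>x. ennreal (v x)) (A - B) powr (1 / p) / \<alpha>) powr q)"
proof -
  let ?V = "rmass (\<lambda>x. ennreal (v x))"
  define M where "M = density lebesgue (\<lambda>x. ennreal (u x))"
  define S where "S k = A \<inter> cball 0 (real k)" for k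
  define F where "F k = fourier (indicator (S k))" for k
  have S: "exhausts S A"
    unfolding S_def by (rule exhausts_cball[OF A])
  have Sm: "S k \<in> sets lebesgue" "bounded (S k)" for k
    using S by (auto simp: exhausts_def)
  have lm: "B \<in> lmeasurable" if "B \<in> sets lebesgue" "bounded B" for B :: "(real^'n) set"
    using that by (simp add: bounded_set_imp_lmeasurable)
  have fm: "fourier (indicator B) \<in> borel_measurable lebesgue" if "B \<in> sets lebesgue" "bounded B" for B :: "(real^'n) set"
    by (rule measurable_completion) (simp add: fourier_indicator_measurable[OF lm[OF that]])
  have Fm: "F k \<in> borel_measurable lebesgue" for k
    unfolding F_def by (rule fm[OF Sm])
  have [simp]: "space M = UNIV" and [measurable_cong, simp]: "sets M = sets lebesgue"
    by (simp_all add: M_def)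
  have MF[measurable]: "F k \<in> borel_measurable M" for k
    using Fm by (simp add: M_def)
  have diff: "mass u {z. \<alpha> < cmod (fourier (indicator B) z - F k z)}
      \<le> ennreal ((C * ?V (A - B) powr (1 / p) / \<alpha>) powr q)"
    if B: "B \<in> sets lebesgue" "bounded B" "B \<subseteq> S k" and \<alpha>: "0 < \<alpha>" for B k \<alpha>
  proof -
    have "cmod (fourier (indicator B) z - F k z) = cmod (fourier (indicator (S k - B)) z)" for z
    proof -
      have "F k z - fourier (indicator B) z = fourier (indicator (S k - B)) z"
        unfolding F_def by (rule fourier_indicator_diff[OF lm[OF B(1,2)] lm[OF Sm] B(3)])
      then show ?thesis
        by (metis norm_minus_commute)
    qed
    moreover have "bounded (S k - B)"
      by (rule bounded_subset[OF Sm(2)]) auto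
    ultimately have "mass u {z. \<alpha> < cmod (fourier (indicator B) z - F k z)} \<le> ennreal ((C * ?V (S k - B) powr (1 / p) / \<alpha>) powr q)"
      using weak[OF sets.Diff[OF Sm(1)[of k] B(1)] _ \<alpha>] by simp
    also have "\<dots> \<le> ennreal ((C * ?V (A - B) powr (1 / p) / \<alpha>) powr q)"
    proof -
      have "?V (S k - B) \<le> ?V (A - B)"
      proof (rule rmass_mono_fin)
        show "mass v (A - B) < \<infinity>"
          by (rule le_less_trans[OF emass_mono fin]) auto
      qed (auto simp: S_def)
      then show ?thesis
        using C \<alpha> p q by (intro ennreal_leI powr_mono2 divide_right_mono mult_left_mono) auto
    qed
    finally show ?thesis .
  qed
  \<comment> \<open>Beyond N i the remaining v-mass is so small that the level set at height 2^-i
    has u-mass at most 2^-i.\<close>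
  have "\<exists>N. \<forall>k\<ge>N. (C * ?V (A - S k) powr (1 / p) / (1 / 2) ^ i) powr q \<le> (1 / 2) ^ i" for i :: nat
  proof -
    have "(\<lambda>k. (C * ?V (A - S k) powr (1 / p) / (1 / 2) ^ i) powr q) \<longlonglongrightarrow> (C * 0 powr (1 / p) / (1 / 2) ^ i) powr q"
      using p q C by (intro tendsto_intros tendsto_powr' rmass_diff_tendsto_0[OF v A fin S]) auto
    then have "\<forall>\<^sub>F k in sequentially. (C * ?V (A - S k) powr (1 / p) / (1 / 2) ^ i) powr q < (1 / 2) ^ i"
      by (rule order_tendstoD(2)) (use p in auto)
    then show ?thesis
      by (auto simp: eventually_sequentially intro: less_imp_le)
  qed
  then obtain N where N: "\<And>i k. N i \<le> k \<Longrightarrow> (C * ?V (A - S k) powr (1 / p) / (1 / 2) ^ i) powr q \<le> (1 / 2) ^ i"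
    by metis
  \<comment> \<open>The partial sums make n increasing and at least N i; the summand i makes it
    unbounded, so the chosen truncations still exhaust A.\<close>
  define n where "n i = i + (\<Sum>j\<le>i. N j)" for i :: nat
  have n: "i \<le> n i" "N i \<le> n i" "n i \<le> n (Suc i)" for i
    using member_le_sum[of i "{..i}" N] by (auto simp: n_def)
  have Smono: "S i \<subseteq> S j" if "i \<le> j" for i j
    using that by (auto simp: S_def)
  \<comment> \<open>\<open>lim\<close> is total, so g is defined and measurable everywhere, while it
    is the actual limit only almost everywhere.\<close>
  define g where "g z = lim (\<lambda>i. F (n i) z)" for z
  have gm: "g \<in> borel_measurable lebesgue"
    unfolding g_def using Fm by measurable
  have "AE z in M. convergent (\<lambda>i. F (n i) z)"
  proof (rule AE_convergent_of_fast_Cauchy)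
    fix i
    have "emeasure M {z \<in> space M. (1 / 2) ^ i < cmod (F (n (Suc i)) z - F (n i) z)}
        = mass u {z. (1 / 2) ^ i < cmod (fourier (indicator (S (n i))) z - F (n (Suc i)) z)}"
      unfolding M_def using Fm
      by (subst mass_superlevel(1)[OF u]) (auto simp: F_def norm_minus_commute)
    also have "\<dots> \<le> ennreal ((C * ?V (A - S (n i)) powr (1 / p) / (1 / 2) ^ i) powr q)"
      by (rule diff[OF Sm Smono]) (use n in auto)
    also have "\<dots> \<le> ennreal ((1 / 2) ^ i)"
      by (intro ennreal_leI N n)
    finally show "emeasure M {z \<in> space M. (1 / 2) ^ i < cmod (F (n (Suc i)) z - F (n i) z)} \<le> ennreal ((1 / 2) ^ i)" .
  qed measurable
  then have lim: "AE z in M. (\<lambda>i. F (n i) z) \<longlonglongrightarrow> g z"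
    unfolding g_def by eventually_elim (simp add: convergent_LIMSEQ_iff)
  have "mass u {z. \<alpha> < cmod (fourier (indicator B) z - g z)}
         \<le> ennreal ((C * ?V (A - B) powr (1 / p) / \<alpha>) powr q)"
    if B: "B \<in> sets lebesgue" "bounded B" "B \<subseteq> A" and \<alpha>: "0 < \<alpha>" for B \<alpha>
  proof -
    obtain m where m: "\<And>x. x \<in> B \<Longrightarrow> norm x \<le> m"
      using B(2) by (auto simp: bounded_iff)
    obtain k where k: "m \<le> real k"
      using real_arch_simple by blast
    \<comment> \<open>The shift by k puts the bounded set B inside every truncation that is used, so
      \<open>diff\<close> bounds each term by the same quantity and Fatou applies.\<close>
    have BS: "B \<subseteq> S (n (i + k))" for i
    proof
      fix x assume x: "x \<in> B"
      have "norm x \<le> m"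
        by (rule m[OF x])
      also note k
      also have "real k \<le> real (n (i + k))"
        using n(1)[of "i + k"] by simp
      finally show "x \<in> S (n (i + k))"
        using x B(3) by (auto simp: S_def)
    qed
    have [measurable]: "fourier (indicator B) \<in> borel_measurable M" "g \<in> borel_measurable M"
      using fm[OF B(1,2)] gm by (simp_all add: M_def)
    have "emeasure M {z \<in> space M. \<alpha> < norm (fourier (indicator B) z - g z)}
       \<le> ennreal ((C * ?V (A - B) powr (1 / p) / \<alpha>) powr q)"
    proof (rule emeasure_superlevel_limit_le)
      show "AE z in M. (\<lambda>i. fourier (indicator B) z - F (n (i + k)) z) \<longlonglongrightarrow> fourier (indicator B) z - g z"
        using lim by eventually_elim (intro tendsto_diff tendsto_const LIMSEQ_ignore_initial_segment)
      fix i
      have "emeasure M {z \<in> space M. \<alpha> < norm (fourier (indicator B) z - F (n (i + k)) z)}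
         = mass u {z. \<alpha> < cmod (fourier (indicator B) z - F (n (i + k)) z)}"
        unfolding M_def using Fm fm[OF B(1,2)]
        by (subst mass_superlevel(1)[OF u]) auto
      also have "\<dots> \<le> ennreal ((C * ?V (A - B) powr (1 / p) / \<alpha>) powr q)"
        by (rule diff[OF B(1,2) BS \<alpha>])
      finally show "emeasure M {z \<in> space M. \<alpha> < norm (fourier (indicator B) z - F (n (i + k)) z)}
         \<le> ennreal ((C * ?V (A - B) powr (1 / p) / \<alpha>) powr q)" .
    qed measurable
    also have "emeasure M {z \<in> space M. \<alpha> < norm (fourier (indicator B) z - g z)}
        = mass u {z. \<alpha> < cmod (fourier (indicator B) z - g z)}"
      unfolding M_def using gm fm[OF B(1,2)]
      by (subst mass_superlevel(1)[OF u]) auto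
    finally show ?thesis .
  qed
  with gm show thesis
    by (rule that)
qed

text \<open>The distance from g to the transform of a bounded B inside A is controlled by v(A - B)
  alone, which tends to 0 along any exhaustion.\<close>

lemma is_fourier_char_exists:
  fixes u v :: "real^'n \<Rightarrow> real"
  assumes p: "1 < p" and q: "1 < q" and u: "weight u" and v: "weight v" and C: "0 < C"
    and weak: "\<And>A \<alpha>. A \<in> sets lebesgue \<Longrightarrow> bounded A \<Longrightarrow> 0 < \<alpha> \<Longrightarrow>
       mass u {z. \<alpha> < cmod (fourier (indicator A) z)}
         \<le> ennreal ((C * rmass (\<lambda>x. ennreal (v x)) A powr (1 / p) / \<alpha>) powr q)"
    and A: "A \<in> sets lebesgue" and fin: "mass v A < \<infinity>"
  shows "\<exists>g. is_fourier_char q u A g"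
proof -
  let ?V = "rmass (\<lambda>x. ennreal (v x))"
  obtain g where g: "g \<in> borel_measurable lebesgue"
    "\<And>B \<alpha>. B \<in> sets lebesgue \<Longrightarrow> bounded B \<Longrightarrow> B \<subseteq> A \<Longrightarrow> 0 < \<alpha> \<Longrightarrow>
       mass u {z. \<alpha> < cmod (fourier (indicator B) z - g z)}
         \<le> ennreal ((C * ?V (A - B) powr (1 / p) / \<alpha>) powr q)"
    using fourier_indicator_limit[OF p q u v C weak A fin] by blast
  have wn: "weak_norm q u (\<lambda>z. fourier (indicator B) z - g z) \<le> ennreal (C * ?V (A - B) powr (1 / p))"
    if "B \<in> sets lebesgue" "bounded B" "B \<subseteq> A" for B
    using q C g(2)[OF that] by (intro weak_norm_le) auto
  \<comment> \<open>The empty set has transform 0, so B = {} in the same estimate gives the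
    finiteness of the quasinorm of g.\<close>
  have "weak_norm q u g = weak_norm q u (\<lambda>z. fourier (indicator {}) z - g z)"
    by (simp add: weak_norm_def fourier_def)
  also have "\<dots> < \<infinity>"
    by (rule le_less_trans[OF wn]) auto
  finally have "g \<in> weak_L q u"
    using g(1) by (simp add: weak_L_def)
  moreover have "(\<lambda>j. weak_norm q u (\<lambda>z. fourier (indicator (S j)) z - g z)) \<longlonglongrightarrow> 0" if S: "exhausts S A" for S
  proof (rule tendsto_sandwich[OF _ _ tendsto_const])
    show "\<forall>\<^sub>F j in sequentially. weak_norm q u (\<lambda>z. fourier (indicator (S j)) z - g z) \<le> ennreal (C * ?V (A - S j) powr (1 / p))"
      using S by (intro always_eventually allI wn) (auto simp: exhausts_def)
    have "(\<lambda>j. C * ?V (A - S j) powr (1 / p)) \<longlonglongrightarrow> C * 0 powr (1 / p)"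
      using p by (intro tendsto_intros tendsto_powr' rmass_diff_tendsto_0[OF v A fin S]) auto
    then show "(\<lambda>j. ennreal (C * ?V (A - S j) powr (1 / p))) \<longlonglongrightarrow> 0"
      using tendsto_ennrealI by fastforce
  qed simp
  ultimately show ?thesis
    by (auto simp: is_fourier_char_def)
qed

lemma mass_superlevel_add_le:
  assumes u: "weight u" and [measurable]: "f \<in> borel_measurable lebesgue" "g \<in> borel_measurable lebesgue"
  shows "mass u {z. \<alpha> + \<beta> < cmod (f z + g z)} \<le> mass u {z. \<alpha> < cmod (f z)} + mass u {z. \<beta> < cmod (g z)}"
proof -
  have "(\<lambda>z. f z + g z) \<in> borel_measurable lebesgue"
    by measurable
  note m = mass_superlevel[OF u assms(2), of \<alpha>] mass_superlevel[OF u assms(3), of \<beta>] mass_superlevel[OF u this, of "\<alpha> + \<beta>"]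
  have "{z. \<alpha> + \<beta> < cmod (f z + g z)} \<subseteq> {z. \<alpha> < cmod (f z)} \<union> {z. \<beta> < cmod (g z)}"
    using norm_triangle_ineq[of "f _" "g _"] by (auto simp: not_less) (smt (verit))
  then have "mass u {z. \<alpha> + \<beta> < cmod (f z + g z)} \<le> emeasure (density lebesgue u) ({z. \<alpha> < cmod (f z)} \<union> {z. \<beta> < cmod (g z)})"
    unfolding m by (intro emeasure_mono) (use m in auto)
  also have "\<dots> \<le> mass u {z. \<alpha> < cmod (f z)} + mass u {z. \<beta> < cmod (g z)}"
    unfolding m by (intro emeasure_subadditive) (use m in auto)
  finally show ?thesis .
qed

text \<open>The estimate must hold for every representative g. The level \<alpha> is split in half
  between a truncated transform and its distance to g, which accounts for the factor 2.\<close>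

lemma is_fourier_char_weak_type:
  fixes u v :: "real^'n \<Rightarrow> real"
  assumes p: "1 < p" and q: "1 < q" and u: "weight u" and C: "0 < C"
    and weak: "\<And>A \<alpha>. A \<in> sets lebesgue \<Longrightarrow> bounded A \<Longrightarrow> 0 < \<alpha> \<Longrightarrow>
       mass u {z. \<alpha> < cmod (fourier (indicator A) z)}
         \<le> ennreal ((C * rmass (\<lambda>x. ennreal (v x)) A powr (1 / p) / \<alpha>) powr q)"
    and A: "A \<in> sets lebesgue" and fin: "mass v A < \<infinity>" and g: "is_fourier_char q u A g" and \<alpha>: "0 < \<alpha>"
  shows "epowr (mass u {z. cmod (g z) > \<alpha>}) (1 / q) \<le> ennreal (2 * C / \<alpha>) * epowr (mass v A) (1 / p)"
proof -
  let ?V = "rmass (\<lambda>x. ennreal (v x))"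
  define S where "S k = A \<inter> cball 0 (real k)" for k
  define F where "F k = fourier (indicator (S k))" for k
  have S: "exhausts S A"
    unfolding S_def by (rule exhausts_cball[OF A])
  have Sm: "S k \<in> sets lebesgue" "bounded (S k)" for k
    using S by (auto simp: exhausts_def)
  have Fm: "F k \<in> borel_measurable lebesgue" for k
    unfolding F_def
    by (rule measurable_completion) (simp add: fourier_indicator_measurable bounded_set_imp_lmeasurable Sm)
  have gm: "g \<in> borel_measurable lebesgue"
    using g by (simp add: is_fourier_char_def weak_L_def)
  define c where "c = ennreal ((2 * C * ?V A powr (1 / p) / \<alpha>) powr q)"
  have "mass u {z. \<alpha> < cmod (g z)} \<le> c"
  proof (rule tendsto_lowerbound)
    have "(\<lambda>k. mass u {z. \<alpha> / 2 < cmod (F k z - g z)}) \<longlonglongrightarrow> 0"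
      using g S q \<alpha> unfolding F_def is_fourier_char_def by (intro mass_superlevel_tendsto_0[where q = q]) auto
    then show "(\<lambda>k. c + mass u {z. \<alpha> / 2 < cmod (F k z - g z)}) \<longlonglongrightarrow> c"
      using tendsto_add[OF tendsto_const[of c]] by fastforce
    have "mass u {z. \<alpha> < cmod (g z)} \<le> c + mass u {z. \<alpha> / 2 < cmod (F k z - g z)}" for k
    proof -
      have "mass u {z. \<alpha> / 2 + \<alpha> / 2 < cmod (F k z + (g z - F k z))} \<le> mass u {z. \<alpha> / 2 < cmod (F k z)} + mass u {z. \<alpha> / 2 < cmod (g z - F k z)}"
        using Fm gm by (intro mass_superlevel_add_le[OF u]) auto
      also have "mass u {z. \<alpha> / 2 < cmod (F k z)} \<le> ennreal ((C * ?V (S k) powr (1 / p) / (\<alpha> / 2)) powr q)"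
        unfolding F_def using \<alpha> by (intro weak Sm) auto
      also have "\<dots> \<le> ennreal ((C * ?V A powr (1 / p) / (\<alpha> / 2)) powr q)"
        using C \<alpha> p q fin
        by (intro ennreal_leI powr_mono2 divide_right_mono mult_left_mono rmass_mono_fin) (auto simp: S_def)
      also have "\<dots> = c"
        by (simp add: c_def mult_ac)
      finally show ?thesis
        by (simp add: norm_minus_commute)
    qed
    then show "\<forall>\<^sub>F k in sequentially. mass u {z. \<alpha> < cmod (g z)} \<le> c + mass u {z. \<alpha> / 2 < cmod (F k z - g z)}"
      by simp
  qed simp
  then have "epowr (mass u {z. \<alpha> < cmod (g z)}) (1 / q) \<le> epowr c (1 / q)"
    using q by (intro epowr_mono) auto
  also have "\<dots> = ennreal (2 * C * ?V A powr (1 / p) / \<alpha>)"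
    using q C \<alpha> by (simp add: c_def epowr_ennreal powr_powr)
  also have "\<dots> = ennreal (2 * C / \<alpha>) * epowr (mass v A) (1 / p)"
  proof -
    have "mass v A = ennreal (?V A)"
      using fin by (simp add: rmass_def)
    then show ?thesis
      using p C \<alpha> by (simp add: epowr_ennreal ennreal_mult[symmetric])
  qed
  finally show ?thesis .
qed

text \<open>The truncated transforms converge to g in u-measure and, since |A| is finite, uniformly
  to the classical transform, with error at most |A - S k|.\<close>

lemma is_fourier_char_AE_eq:
  fixes u :: "real^'n \<Rightarrow> real"
  assumes q: "1 < q" and u: "weight u" and A: "A \<in> sets lebesgue" and fin: "emeasure lebesgue A < \<infinity>"
    and g: "is_fourier_char q u A g"
  shows "AE z in density lebesgue (\<lambda>z. ennreal (u z)). g z = fourier (indicator A) z"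
proof -
  define S where "S k = A \<inter> cball 0 (real k)" for k
  define F where "F k = fourier (indicator (S k))" for k
  have S: "exhausts S A"
    unfolding S_def by (rule exhausts_cball[OF A])
  have Sm: "S k \<in> sets lebesgue" "bounded (S k)" for k
    using S by (auto simp: exhausts_def)
  have Al: "A \<in> lmeasurable"
    using A fin by (intro fmeasurableI) auto
  have Sl: "S k \<in> lmeasurable" for k
    by (simp add: bounded_set_imp_lmeasurable Sm)
  have Fm: "F k \<in> borel_measurable lebesgue" for k
    unfolding F_def by (rule measurable_completion) (simp add: fourier_indicator_measurable Sl)
  have Am: "fourier (indicator A) \<in> borel_measurable lebesgue"
    by (rule measurable_completion) (simp add: fourier_indicator_measurable Al)
  have gm: "g \<in> borel_measurable lebesgue"
    using g by (simp add: is_fourier_char_def weak_L_def)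
  have dm: "(\<lambda>z. g z - fourier (indicator A) z) \<in> borel_measurable lebesgue"
    using gm Am by measurable
  have tail: "(\<lambda>k. measure lebesgue (A - S k)) \<longlonglongrightarrow> 0"
  proof -
    have "(\<lambda>k. measure lebesgue (A - S k)) \<longlonglongrightarrow> measure lebesgue (\<Inter>k. A - S k)"
    proof (rule Lim_measure_decseq)
      show "decseq (\<lambda>k. A - S k)"
        using S by (auto simp: exhausts_def decseq_def incseq_def)
      show "emeasure lebesgue (A - S k) \<noteq> \<infinity>" for k
        using fmeasurableD2[OF fmeasurable_Diff[OF Al Sm(1)[of k]]] by (simp del: emeasure_completion)
    qed (use A Sm in auto)
    moreover have "(\<Inter>k. A - S k) = {}"
      using S by (auto simp: exhausts_def)
    ultimately show ?thesis
      by (metis measure_empty)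
  qed
  have null: "mass u {z. \<alpha> < cmod (g z - fourier (indicator A) z)} = 0" if \<alpha>: "0 < \<alpha>" for \<alpha>
  proof -
    have "mass u {z. \<alpha> < cmod (g z - fourier (indicator A) z)} \<le> 0"
    proof (rule tendsto_lowerbound)
      show "(\<lambda>k. mass u {z. \<alpha> / 2 < cmod (F k z - g z)}) \<longlonglongrightarrow> 0"
        using g S q \<alpha> unfolding F_def is_fourier_char_def by (intro mass_superlevel_tendsto_0[where q = q]) auto
      have "\<forall>\<^sub>F k in sequentially. measure lebesgue (A - S k) < \<alpha> / 2"
        using \<alpha> by (intro order_tendstoD(2)[OF tail]) auto
      then show "\<forall>\<^sub>F k in sequentially. mass u {z. \<alpha> < cmod (g z - fourier (indicator A) z)} \<le> mass u {z. \<alpha> / 2 < cmod (F k z - g z)}"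
      proof eventually_elim
        case (elim k)
        \<comment> \<open>The uniform error takes up less than half of \<alpha>, so a gap above
          \<alpha> between g and the classical transform forces a gap above \<alpha> / 2 between g
          and the truncation.\<close>
        have "cmod (fourier (indicator A) z - F k z) < \<alpha> / 2" for z
        proof -
          have "fourier (indicator A) z - F k z = fourier (indicator (A - S k)) z"
            unfolding F_def by (rule fourier_indicator_diff[OF Sl Al]) (auto simp: S_def)
          then show ?thesis
            using norm_fourier_indicator_le[OF fmeasurable_Diff[OF Al Sm(1)[of k]], of z] elim by simp
        qed
        note close = this
        have "\<alpha> / 2 < cmod (F k z - g z)" if "\<alpha> < cmod (g z - fourier (indicator A) z)" for z
          using that close[of z] norm_triangle_ineq[of "g z - F k z" "F k z - fourier (indicator A) z"]
          by (simp add: norm_minus_commute)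
        then show ?case
          by (intro emass_mono) auto
      qed
    qed simp
    then show ?thesis
      by simp
  qed
  \<comment> \<open>Countably many levels 1 / (n + 1) detect every nonzero difference.\<close>
  have "AE z in density lebesgue (\<lambda>z. ennreal (u z)). \<forall>n::nat. \<not> 1 / real (Suc n) < cmod (g z - fourier (indicator A) z)"
    unfolding AE_all_countable
  proof
    fix n :: nat
    have "{z. 1 / real (Suc n) < cmod (g z - fourier (indicator A) z)} \<in> null_sets (density lebesgue (\<lambda>z. ennreal (u z)))"
      using null[of "1 / real (Suc n)"] mass_superlevel[OF u dm, of "1 / real (Suc n)"] by (auto simp: null_sets_def)
    then show "AE z in density lebesgue (\<lambda>z. ennreal (u z)). \<not> 1 / real (Suc n) < cmod (g z - fourier (indicator A) z)"
      by (rule AE_I') auto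
  qed
  then show ?thesis
  proof eventually_elim
    case (elim z)
    show ?case
    proof (rule ccontr)
      assume "g z \<noteq> fourier (indicator A) z"
      then have "0 < cmod (g z - fourier (indicator A) z)"
        by simp
      then obtain n where "1 / real (Suc n) < cmod (g z - fourier (indicator A) z)"
        using nat_approx_posE by blast
      with elim show False
        by blast
    qed
  qed
qed

theorem theorem4:
  fixes p q :: real and u v :: "real^'n \<Rightarrow> real"
  assumes "1 < p" and "1 < q"
    and "weight u" and "weight v"
    and "locally_integrable (dual_weight p v)"
    and "(u, v) \<in> N_Q p q"
  shows "(cube_condition p q u v \<longrightarrow> bounded_set_condition p q u v) \<and>
         (bounded_set_condition p q u v \<longrightarrow>
            (max (conj_exp p) q \<ge> 2 \<longrightarrow>
               fourier_extends q u v \<and> restricted_weak_type p q u v))"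
proof (intro conjI impI)
  show "bounded_set_condition p q u v" if "cube_condition p q u v"
    using assms that by (rule cube_condition_imp_bounded_set_condition)
next
  assume bsc: "bounded_set_condition p q u v" and s: "max (conj_exp p) q \<ge> 2"
  obtain C where C: "0 < C"
    and weak: "\<And>A \<alpha>. A \<in> sets lebesgue \<Longrightarrow> bounded A \<Longrightarrow> 0 < \<alpha> \<Longrightarrow>
       mass u {z. \<alpha> < cmod (fourier (indicator A) z)}
         \<le> ennreal ((C * rmass (\<lambda>x. ennreal (v x)) A powr (1 / p) / \<alpha>) powr q)"
    using bounded_set_condition_weak_type[OF assms(1-4) bsc s] by metis
  show "fourier_extends q u v"
    unfolding fourier_extends_def
    using is_fourier_char_exists[OF assms(1-4) C weak] is_fourier_char_AE_eq[OF assms(2,3)] by blast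
  show "restricted_weak_type p q u v"
    unfolding restricted_weak_type_def
    using is_fourier_char_weak_type[OF assms(1-3) C weak] by blast
qed

end
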